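(* Let $m$ and $q$ be positive integers and let $I=\{(d_i,\ell_i): i\in[m]\}$ be a set of $m$ pairs of positive integers with $q\ge\max_{i\in[m]} d_i$. For each $i\in[m]$ let $\eta_i=\eta(d_i,\ell_i,q)$, suppose $\eta_i\ge2$ for all $i\in[m]$, and set $\eta=\max_{i\in[m]}\eta_i$. Then the $(I,q)$-Generalized Uniformly Rainbow Free Coloring problem parameterized by the number of vertices $n$ admits a kernel with $O(n^\eta)$ constraints. Moreover, given an instance $(G,\mathcal{F})$, the kernel returns an instance $(G,\mathcal{F}')$ with $\mathcal{F}'\subseteq\mathcal{F}$ such that $(G,\mathcal{F})$ and $(G,\mathcal{F}')$ have the same solution set.
   Context: For a coloring $c$ of $V$, an $\ell$-tuple $(F_1,\dots,F_\ell)$ of $d$-subsets of $V$ is uniformly rainbow w.r.t. $c$ if the sets $\{c(v):v\in F_j\}$, $j\in[\ell]$, are all equal and of size $d$. The $(I,q)$-Generalized Uniformly Rainbow Free Coloring problem: input is a graph $G=(V,E)$ and a collection $\mathcal{F}=\bigcup_{i\in[m]}\mathcal{F}_i$ where $\mathcal{F}_i$ is a collection of $\ell_i$-tuples of $d_i$-subsets of $V$; decide whether there is a proper coloring $c:V\to[q]$ of $G$ with no tuple of $\mathcal{F}$ uniformly rainbow. The solution set is the set of all such colorings; the number of constraints is $|E|+|\mathcal{F}|$; parameter $n=|V|$. A kernel with $O(n^\eta)$ constraints is a polynomial-time algorithm mapping each instance to an equivalent instance of the same problem with $O(n^\eta)$ constraints. $\eta(d,\ell,q)$ (for $q\ge d$)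 is: $d\ell$ if $\ell\ge2$ and $q\ge d+2$; $d\ell-1$ if $\ell\ge2$, $q=d+1$ and $(d,\ell)\ne(1,2)$; $(d-1)\ell$ if ($\ell\ge2$ and $q=d\ge2$) or ($\ell=1$ and $d\ge3$); $2$ if $\ell=1$, $d\le2$ and $q\ge3$; $0$ if ($q=2$ and $d\ell\le2$) or $q=1$. *)

theory Defs
  imports "HOL-Library.FuncSet" "HOL-Computational_Algebra.Polynomial"
begin

section \<open>Polynomial-time computation\<close>

text \<open>
  The machine model is a WHILE language over binary trees, in the style of N. D. Jones
  (\<^emph>\<open>Computability and Complexity\<close>). Every (sub)expression is charged the size of the tree
  it evaluates to, so that running time dominates the size of all data that is read or written
  (sharing of subtrees brings no advantage), and polynomial time is the same as for Turing machines.
\<close>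

datatype tree = Leaf | Branch tree tree

datatype expr =
    Var nat
  | Const_Leaf
  | Mk_Branch expr expr
  | Left_Of expr
  | Right_Of expr
  | Test_Eq expr expr

datatype com =
    Skip
  | Assign nat expr
  | Seq com com
  | If_Branch expr com com
  | While_Branch expr com

type_synonym state = "nat \<Rightarrow> tree"

fun left_subtree :: "tree \<Rightarrow> tree" where
  "left_subtree Leaf = Leaf"
| "left_subtree (Branch a b) = a"

fun right_subtree :: "tree \<Rightarrow> tree" where
  "right_subtree Leaf = Leaf"
| "right_subtree (Branch a b) = b"

text \<open>Truth values: \<^const>\<open>Leaf\<close> is false, every other tree is true.\<close>

definition bool_tree :: "bool \<Rightarrow> tree" where
  "bool_tree b = (if b then Branch Leaf Leaf else Leaf)"

fun eval :: "expr \<Rightarrow> state \<Rightarrow> tree" where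
  "eval (Var x) s = s x"
| "eval Const_Leaf s = Leaf"
| "eval (Mk_Branch e f) s = Branch (eval e s) (eval f s)"
| "eval (Left_Of e) s = left_subtree (eval e s)"
| "eval (Right_Of e) s = right_subtree (eval e s)"
| "eval (Test_Eq e f) s = bool_tree (eval e s = eval f s)"

fun eval_cost :: "expr \<Rightarrow> state \<Rightarrow> nat" where
  "eval_cost (Var x) s = 1 + size (s x)"
| "eval_cost Const_Leaf s = 1"
| "eval_cost (Mk_Branch e f) s =
    eval_cost e s + eval_cost f s + 1 + size (eval (Mk_Branch e f) s)"
| "eval_cost (Left_Of e) s = eval_cost e s + 1 + size (eval (Left_Of e) s)"
| "eval_cost (Right_Of e) s = eval_cost e s + 1 + size (eval (Right_Of e) s)"
| "eval_cost (Test_Eq e f) s =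
    eval_cost e s + eval_cost f s + 1 + size (eval (Test_Eq e f) s)"

text \<open>\<open>exec c s n s'\<close>: started in \<open>s\<close>, \<open>c\<close> terminates in \<open>s'\<close> after time \<open>n\<close>.\<close>

inductive exec :: "com \<Rightarrow> state \<Rightarrow> nat \<Rightarrow> state \<Rightarrow> bool" where
  Skip: "exec Skip s 1 s"
| Assign: "exec (Assign x e) s (1 + eval_cost e s) (s(x := eval e s))"
| Seq: "exec c s m s' \<Longrightarrow> exec d s' n s'' \<Longrightarrow> exec (Seq c d) s (1 + m + n) s''"
| If_True: "eval e s \<noteq> Leaf \<Longrightarrow> exec c s n s' \<Longrightarrow>
    exec (If_Branch e c d) s (1 + eval_cost e s + n) s'"
| If_False: "eval e s = Leaf \<Longrightarrow> exec d s n s' \<Longrightarrow>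
    exec (If_Branch e c d) s (1 + eval_cost e s + n) s'"
| While_False: "eval e s = Leaf \<Longrightarrow> exec (While_Branch e c) s (1 + eval_cost e s) s"
| While_True: "eval e s \<noteq> Leaf \<Longrightarrow> exec c s m s' \<Longrightarrow> exec (While_Branch e c) s' n s'' \<Longrightarrow>
    exec (While_Branch e c) s (1 + eval_cost e s + m + n) s''"

inductive_cases exec_SkipE: "exec Skip s n s'"
inductive_cases exec_AssignE: "exec (Assign x e) s n s'"
inductive_cases exec_SeqE: "exec (Seq c d) s n s'"
inductive_cases exec_IfE: "exec (If_Branch e c d) s n s'"
inductive_cases exec_WhileE: "exec (While_Branch e c) s n s'"

lemma exec_deterministic:
  "exec c s n s' \<Longrightarrow> exec c s m s'' \<Longrightarrow> n = m \<and> s' = s''"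
proof (induction arbitrary: m s'' rule: exec.induct)
  case Skip
  from Skip.prems show ?case by (rule exec_SkipE) simp
next
  case Assign
  from Assign.prems show ?case by (rule exec_AssignE) simp
next
  case Seq
  from Seq.prems show ?case by (rule exec_SeqE) (metis Seq.IH add_Suc plus_1_eq_Suc)
next
  case If_True
  from If_True.prems show ?case by (rule exec_IfE)
    (metis If_True.hyps If_True.IH add_Suc plus_1_eq_Suc)+
next
  case If_False
  from If_False.prems show ?case by (rule exec_IfE)
    (metis If_False.hyps If_False.IH add_Suc plus_1_eq_Suc)+
next
  case While_False
  from While_False.prems show ?case by (rule exec_WhileE) (use While_False.hyps in simp)+
next
  case While_True
  from While_True.prems show ?case by (rule exec_WhileE)
    (metis While_True.hyps While_True.IH add_Suc plus_1_eq_Suc)+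
qed

text \<open>Input and output are held in variable \<open>0\<close>; all other variables are initially \<^const>\<open>Leaf\<close>.\<close>

definition computes_in :: "com \<Rightarrow> tree \<Rightarrow> nat \<Rightarrow> tree \<Rightarrow> bool" where
  "computes_in c t n t' \<longleftrightarrow> (\<exists>s. exec c ((\<lambda>_. Leaf)(0 := t)) n s \<and> s 0 = t')"

definition computes :: "com \<Rightarrow> tree \<Rightarrow> tree \<Rightarrow> bool" where
  "computes c t t' \<longleftrightarrow> (\<exists>n. computes_in c t n t')"

definition polynomial_time_on :: "tree set \<Rightarrow> com \<Rightarrow> bool" where
  "polynomial_time_on D c \<longleftrightarrow>
     (\<exists>b :: nat poly. \<forall>t\<in>D. \<exists>n t'. computes_in c t n t' \<and> n \<le> poly b (size t))"


section \<open>Tree encodings\<close>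

text \<open>
  Natural numbers are encoded in binary, least significant bit first. A finite set is encoded by
  listing its elements without repetition, in any order; encodings are therefore relations.
\<close>

fun nat_tree :: "nat \<Rightarrow> tree" where
  "nat_tree n = (if n = 0 then Leaf else Branch (bool_tree (odd n)) (nat_tree (n div 2)))"

declare nat_tree.simps [simp del]

fun list_tree :: "tree list \<Rightarrow> tree" where
  "list_tree [] = Leaf"
| "list_tree (t # ts) = Branch t (list_tree ts)"

definition encodes_nat :: "nat \<Rightarrow> tree \<Rightarrow> bool" where
  "encodes_nat n t \<longleftrightarrow> t = nat_tree n"

definition encodes_list :: "('a \<Rightarrow> tree \<Rightarrow> bool) \<Rightarrow> 'a list \<Rightarrow> tree \<Rightarrow> bool" where
  "encodes_list R xs t \<longleftrightarrow> (\<exists>ts. list_all2 R xs ts \<and> t = list_tree ts)"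

definition encodes_set :: "('a \<Rightarrow> tree \<Rightarrow> bool) \<Rightarrow> 'a set \<Rightarrow> tree \<Rightarrow> bool" where
  "encodes_set R A t \<longleftrightarrow> (\<exists>xs. distinct xs \<and> set xs = A \<and> encodes_list R xs t)"


section \<open>Generalized Uniformly Rainbow Free Coloring\<close>

text \<open>An instance \<open>(V, E, \<F>)\<close>; an \<open>\<ell>\<close>-tuple of vertex sets is a list of length \<open>\<ell>\<close>.\<close>

type_synonym inst = "nat set \<times> nat set set \<times> nat set list set"

definition subset_tuples :: "nat set \<Rightarrow> nat \<Rightarrow> nat \<Rightarrow> nat set list set" where
  "subset_tuples V d l = {ts. length ts = l \<and> (\<forall>S\<in>set ts. S \<subseteq> V \<and> card S = d)}"

fun is_instance :: "(nat \<times> nat) set \<Rightarrow> inst \<Rightarrow> bool" where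
  "is_instance I (V, E, \<F>) \<longleftrightarrow>
     finite V \<and> E \<subseteq> {e. e \<subseteq> V \<and> card e = 2} \<and> \<F> \<subseteq> (\<Union>(d, l)\<in>I. subset_tuples V d l)"

definition uniformly_rainbow :: "nat \<Rightarrow> (nat \<Rightarrow> nat) \<Rightarrow> nat set list \<Rightarrow> bool" where
  "uniformly_rainbow d c ts \<longleftrightarrow> (\<exists>C. card C = d \<and> (\<forall>S\<in>set ts. c ` S = C))"

text \<open>
  As \<open>d\<close> and \<open>\<ell>\<close> are positive, a tuple lies in \<^term>\<open>subset_tuples V d l\<close> for at most one pair
  \<open>(d, \<ell>)\<close>, so \<open>\<F>\<close> determines its parts \<open>\<F> \<inter> subset_tuples V d l\<close>.
\<close>

fun solutions :: "(nat \<times> nat) set \<Rightarrow> nat \<Rightarrow> inst \<Rightarrow> (nat \<Rightarrow> nat) set" where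
  "solutions I q (V, E, \<F>) =
     {c \<in> V \<rightarrow>\<^sub>E {1..q}.
        (\<forall>u v. {u, v} \<in> E \<longrightarrow> c u \<noteq> c v) \<and>
        (\<forall>(d, l)\<in>I. \<forall>ts \<in> \<F> \<inter> subset_tuples V d l. \<not> uniformly_rainbow d c ts)}"

fun num_vertices :: "inst \<Rightarrow> nat" where
  "num_vertices (V, E, \<F>) = card V"

fun num_constraints :: "inst \<Rightarrow> nat" where
  "num_constraints (V, E, \<F>) = card E + card \<F>"

fun encodes_inst :: "inst \<Rightarrow> tree \<Rightarrow> bool" where
  "encodes_inst (V, E, \<F>) t \<longleftrightarrow>
     (\<exists>tV tE tF. t = Branch tV (Branch tE tF) \<and>
        encodes_set encodes_nat V tV \<and>
        encodes_set (encodes_set encodes_nat) E tE \<and>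
        encodes_set (encodes_list (encodes_set encodes_nat)) \<F> tF)"

text \<open>\<open>constraint_kernel I q e K\<close>: the program \<open>K\<close> is a kernel with \<open>O(n\<^sup>e)\<close> constraints.\<close>

definition constraint_kernel :: "(nat \<times> nat) set \<Rightarrow> nat \<Rightarrow> nat \<Rightarrow> com \<Rightarrow> bool" where
  "constraint_kernel I q e K \<longleftrightarrow>
     polynomial_time_on {t. \<exists>X. is_instance I X \<and> encodes_inst X t} K \<and>
     (\<exists>C :: nat. \<forall>X t. is_instance I X \<and> encodes_inst X t \<longrightarrow>
        (\<exists>X' t'. computes K t t' \<and> encodes_inst X' t' \<and> is_instance I X' \<and>
           (solutions I q X' \<noteq> {} \<longleftrightarrow> solutions I q X \<noteq> {}) \<and>
           num_constraints X' \<le> C * num_vertices X ^ e))"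

text \<open>Only meaningful for \<open>d, \<ell> \<ge> 1\<close> and \<open>q \<ge> d\<close>, where exactly one of the cases applies.\<close>

definition eta :: "nat \<Rightarrow> nat \<Rightarrow> nat \<Rightarrow> nat" where
  "eta d l q =
     (if l \<ge> 2 \<and> q \<ge> d + 2 then d * l
      else if l \<ge> 2 \<and> q = d + 1 \<and> (d, l) \<noteq> (1, 2) then d * l - 1
      else if (l \<ge> 2 \<and> q = d \<and> d \<ge> 2) \<or> (l = 1 \<and> d \<ge> 3) then (d - 1) * l
      else if l = 1 \<and> d \<le> 2 \<and> q \<ge> 3 then 2
      else 0)"


section \<open>Adequacy of the encoding\<close>

lemma nat_tree_inject: "nat_tree m = nat_tree n \<Longrightarrow> m = n"
proof (induction m arbitrary: n rule: less_induct)
  case (less m)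
  show ?case
  proof (cases "m = 0 \<or> n = 0")
    case True
    with less.prems show ?thesis
      by (auto simp: nat_tree.simps[of m] nat_tree.simps[of n] split: if_splits)
  next
    case False
    with less.prems have "odd m = odd n" "nat_tree (m div 2) = nat_tree (n div 2)"
      by (auto simp: nat_tree.simps[of m] nat_tree.simps[of n] bool_tree_def split: if_splits)
    moreover from this(2) False have "m div 2 = n div 2"
      by (intro less.IH) auto
    ultimately show ?thesis
      by (metis even_iff_mod_2_eq_zero odd_iff_mod_2_eq_one div_mult_mod_eq)
  qed
qed

lemma list_tree_inject: "list_tree ts = list_tree us \<Longrightarrow> ts = us"
proof (induction ts arbitrary: us)
  case Nil
  then show ?case by (cases us) auto
next
  case (Cons t ts)
  then show ?case by (cases us) auto
qed

lemma left_unique_encodes_nat: "left_unique encodes_nat"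
  by (auto simp: left_unique_def encodes_nat_def dest: nat_tree_inject)

lemma left_unique_encodes_list: "left_unique R \<Longrightarrow> left_unique (encodes_list R)"
  by (drule list.left_unique_rel)
     (auto simp: left_unique_def encodes_list_def dest!: list_tree_inject)

lemma left_unique_encodes_set: "left_unique R \<Longrightarrow> left_unique (encodes_set R)"
  by (drule left_unique_encodes_list)
     (unfold left_unique_def encodes_set_def, blast)

lemma encodes_inst_unique: "encodes_inst X t \<Longrightarrow> encodes_inst Y t \<Longrightarrow> X = Y"
  using left_unique_encodes_set[OF left_unique_encodes_nat]
    left_unique_encodes_set[OF left_unique_encodes_set[OF left_unique_encodes_nat]]
    left_unique_encodes_set[OF left_unique_encodes_list[OF
      left_unique_encodes_set[OF left_unique_encodes_nat]]]
  by (cases X; cases Y) (simp, unfold left_unique_def, blast)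

lemma encodes_list_exists: "(\<And>x. x \<in> set xs \<Longrightarrow> \<exists>t. R x t) \<Longrightarrow> \<exists>t. encodes_list R xs t"
proof (induction xs)
  case Nil
  then show ?case by (auto simp: encodes_list_def)
next
  case (Cons x xs)
  then obtain t ts where "R x t" "list_all2 R xs ts"
    by (fastforce simp: encodes_list_def)
  then have "list_all2 R (x # xs) (t # ts)" by simp
  then show ?case unfolding encodes_list_def by blast
qed

lemma encodes_set_exists:
  assumes "finite A" "\<And>x. x \<in> A \<Longrightarrow> \<exists>t. R x t"
  shows "\<exists>t. encodes_set R A t"
proof -
  from assms(1) obtain xs where "distinct xs" "set xs = A"
    using finite_distinct_list by blast
  with encodes_list_exists[of xs R] assms(2) show ?thesis
    unfolding encodes_set_def by blast
qed

lemma encodes_inst_exists: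
  assumes "is_instance I X" "finite I"
  shows "\<exists>t. encodes_inst X t"
proof -
  obtain V E F where X: "X = (V, E, F)" by (cases X)
  from assms(1) have V: "finite V" and E: "E \<subseteq> Pow V"
    and F: "F \<subseteq> (\<Union>(d, l)\<in>I. {ts. set ts \<subseteq> Pow V \<and> length ts = l})"
  proof -
    have "(\<Union>(d, l)\<in>I. subset_tuples V d l) \<subseteq>
        (\<Union>(d, l)\<in>I. {ts. set ts \<subseteq> Pow V \<and> length ts = l})"
      by (rule UN_mono) (auto simp: subset_tuples_def)
    with assms(1) show "F \<subseteq> (\<Union>(d, l)\<in>I. {ts. set ts \<subseteq> Pow V \<and> length ts = l})"
      unfolding X is_instance.simps by (meson subset_trans)
  qed (auto simp: X)
  have "finite E" using finite_subset[OF E] V by simp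
  moreover have "finite F"
    by (rule finite_subset[OF F]) (use V assms(2) in \<open>auto intro!: finite_lists_length_eq\<close>)
  moreover have S: "\<exists>t. encodes_set encodes_nat S t" if "S \<subseteq> V" for S
    using finite_subset[OF that V] by (rule encodes_set_exists) (simp add: encodes_nat_def)
  moreover have "\<exists>t. encodes_list (encodes_set encodes_nat) ts t" if "ts \<in> F" for ts
    by (rule encodes_list_exists, rule S) (use that F in auto)
  ultimately obtain tV tE tF where "encodes_set encodes_nat V tV"
    "encodes_set (encodes_set encodes_nat) E tE"
    "encodes_set (encodes_list (encodes_set encodes_nat)) F tF"
    using E encodes_set_exists[of E "encodes_set encodes_nat"]
      encodes_set_exists[of F "encodes_list (encodes_set encodes_nat)"] by blast
  then show ?thesis unfolding X by auto
qed

end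

theory Submission imports Defs begin

text \<open>
  A constraint \<open>(F\<^sub>1, \<dots>, F\<^sub>\<ell>)\<close> is mapped to a vector over the two-element field, indexed by tuples of
  vertex sets, and a basis of the span of these vectors is kept. When \<open>q = d\<close> or \<open>\<ell> = 1\<close> the vector is
  the product of the boundaries of the \<open>F\<^sub>j\<close>, the boundary of \<open>F\<close> being the sum of its \<open>(d-1)\<close>-subsets.
  For a coloring \<open>c\<close> and a set \<open>A\<close> of \<open>d - 1\<close> colors, the number of \<open>(d-1)\<close>-subsets of \<open>F\<close> with color
  set \<open>A\<close> is odd iff \<open>F\<close> is rainbow and its colors include \<open>A\<close>; hence \<open>A\<close> yields a linear functional that
  is nonzero only on uniformly rainbow tuples, and every uniformly rainbow tuple is detected by some
  functional of this kind. When \<open>q = d + 1\<close>, write \<open>e\<^sub>j\<close> for the indicator of \<open>c(F\<^sub>j) = A \<union> {a}\<close> and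
  \<open>\<delta>\<^sub>j\<close> for the parity above. Then \<open>e\<^sub>j + \<delta>\<^sub>j\<close> is the indicator of \<open>c(F\<^sub>j) = A \<union> {a'}\<close> for the other
  color \<open>a'\<close> outside \<open>A\<close>, and in \<open>\<Prod> (e\<^sub>j + \<delta>\<^sub>j) + \<Prod> e\<^sub>j\<close> the term of degree \<open>d \<ell>\<close> cancels. Any vector not
  in the span of the vectors kept so far contributes a new pivot, so at most as many constraints
  survive as there are index tuples.
\<close>

section \<open>Polynomial-time tree functions\<close>

lemma poly_nat_mono: "a \<le> b \<Longrightarrow> poly (p :: nat poly) a \<le> poly p b"
  by (induction p) (auto intro!: add_mono mult_mono)

definition poly_bounded :: "(tree \<Rightarrow> nat) \<Rightarrow> bool" where
  "poly_bounded f \<longleftrightarrow> (\<exists>p :: nat poly. \<forall>t. f t \<le> poly p (size t))"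

lemma poly_bounded_const: "poly_bounded (\<lambda>_. k)"
  unfolding poly_bounded_def by (rule exI[of _ "[:k:]"]) simp

lemma poly_bounded_size: "poly_bounded size"
  unfolding poly_bounded_def by (rule exI[of _ "[:0, 1:]"]) simp

lemma poly_bounded_add: "poly_bounded f \<Longrightarrow> poly_bounded g \<Longrightarrow> poly_bounded (\<lambda>t. f t + g t)"
  unfolding poly_bounded_def by (elim exE, rule_tac x = "p + pa" in exI) (simp add: add_mono)

lemma poly_bounded_mult: "poly_bounded f \<Longrightarrow> poly_bounded g \<Longrightarrow> poly_bounded (\<lambda>t. f t * g t)"
  unfolding poly_bounded_def by (elim exE, rule_tac x = "p * pa" in exI) (simp add: mult_mono)

lemma poly_bounded_poly:
  assumes "poly_bounded f"
  shows "poly_bounded (\<lambda>t. poly p (f t))"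
proof -
  obtain r where r: "\<And>t. f t \<le> poly r (size t)"
    using assms unfolding poly_bounded_def by blast
  have "poly p (f t) \<le> poly (pcompose p r) (size t)" for t
    by (simp add: poly_pcompose poly_nat_mono r)
  then show ?thesis unfolding poly_bounded_def by blast
qed

lemma poly_bounded_le: "poly_bounded g \<Longrightarrow> (\<And>t. f t \<le> g t) \<Longrightarrow> poly_bounded f"
  unfolding poly_bounded_def by (meson order_trans)

lemmas poly_bounded_intros =
  poly_bounded_const poly_bounded_add poly_bounded_mult poly_bounded_poly

text \<open>\<open>exec\<close> fixes the exact time, which depends on the sizes of intermediate
  values and on the branches taken. An upper bound can be weakened after each composition.\<close>

definition runs :: "com \<Rightarrow> state \<Rightarrow> nat \<Rightarrow> state \<Rightarrow> bool" where
  "runs c s T s' \<longleftrightarrow> (\<exists>n\<le>T. exec c s n s')"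

lemma runs_mono: "runs c s T s' \<Longrightarrow> T \<le> T' \<Longrightarrow> runs c s T' s'"
  unfolding runs_def by (meson order_trans)

lemma runs_Assign: "runs (Assign x e) s (1 + eval_cost e s) (s(x := eval e s))"
  unfolding runs_def using exec.Assign by blast

lemma runs_Seq:
  assumes "runs c s T s'" "runs d s' T' s''"
  shows "runs (Seq c d) s (1 + T + T') s''"
proof -
  obtain n m where "n \<le> T" "exec c s n s'" "m \<le> T'" "exec d s' m s''"
    using assms unfolding runs_def by blast
  then have "exec (Seq c d) s (1 + n + m) s''" "1 + n + m \<le> 1 + T + T'"
    by (auto simp del: One_nat_def plus_1_eq_Suc intro: exec.Seq)
  then show ?thesis unfolding runs_def by blast
qed

lemma runs_If:
  assumes "runs (if eval e s \<noteq> Leaf then c else d) s T s'"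
  shows "runs (If_Branch e c d) s (1 + eval_cost e s + T) s'"
proof -
  obtain n where "n \<le> T" "exec (if eval e s \<noteq> Leaf then c else d) s n s'"
    using assms unfolding runs_def by blast
  then have "exec (If_Branch e c d) s (1 + eval_cost e s + n) s'"
      "1 + eval_cost e s + n \<le> 1 + eval_cost e s + T"
    by (auto simp del: One_nat_def plus_1_eq_Suc intro: exec.If_True exec.If_False split: if_splits)
  then show ?thesis unfolding runs_def by blast
qed

lemma runs_While_False:
  "eval e s = Leaf \<Longrightarrow> runs (While_Branch e c) s (1 + eval_cost e s) s"
  unfolding runs_def using exec.While_False by blast

lemma runs_While_True:
  assumes "eval e s \<noteq> Leaf" "runs c s T s'" "runs (While_Branch e c) s' T' s''"
  shows "runs (While_Branch e c) s (1 + eval_cost e s + T + T') s''"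
proof -
  obtain n m where "n \<le> T" "exec c s n s'" "m \<le> T'" "exec (While_Branch e c) s' m s''"
    using assms unfolding runs_def by blast
  then have "exec (While_Branch e c) s (1 + eval_cost e s + n + m) s''"
      "1 + eval_cost e s + n + m \<le> 1 + eval_cost e s + T + T'"
    using assms(1) by (auto simp del: One_nat_def plus_1_eq_Suc intro: exec.While_True)
  then show ?thesis unfolding runs_def by blast
qed

lemma size_eval_le: "size (eval e s) \<le> eval_cost e s"
  by (cases e) auto

text \<open>Every assigned value has been charged its size, so no variable grows by more than the
  time spent.\<close>

lemma exec_size_le: "exec c s n s' \<Longrightarrow> size (s' x) \<le> size (s x) + n"
proof (induction rule: exec.induct)
  case (Assign y e s)
  then show ?case using size_eval_le[of e s] by auto
qed auto

lemma runs_size_le: "runs c s T s' \<Longrightarrow> size (s' x) \<le> size (s x) + T"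
  unfolding runs_def using exec_size_le by (meson add_left_mono order_trans)

text \<open>
  Quantifying over all start states, not only the initial one, makes programs composable; variables
  from \<open>N\<close> on are left alone and hence can hold values across a call.
\<close>

definition realizes :: "com \<Rightarrow> nat \<Rightarrow> nat poly \<Rightarrow> (tree \<Rightarrow> tree) \<Rightarrow> bool" where
  "realizes c N b f \<longleftrightarrow> (\<forall>s. \<exists>s'. runs c s (poly b (size (s 0))) s' \<and> s' 0 = f (s 0) \<and>
     (\<forall>i\<ge>N. s' i = s i))"

definition polytime :: "(tree \<Rightarrow> tree) \<Rightarrow> bool" where
  "polytime f \<longleftrightarrow> (\<exists>c N b. realizes c N b f)"

lemma realizesD:
  assumes "realizes c N b f"
  obtains s' where "runs c s (poly b (size (s 0))) s'" "s' 0 = f (s 0)" "\<And>i. i \<ge> N \<Longrightarrow> s' i = s i"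
  using assms unfolding realizes_def by blast

text \<open>The time may be given by any polynomially bounded function of the input tree, so that
  sizes of intermediate results can appear in it directly.\<close>

lemma polytimeI:
  assumes "poly_bounded T"
    and "\<And>s. \<exists>s'. runs c s (T (s 0)) s' \<and> s' 0 = f (s 0) \<and> (\<forall>i\<ge>N. s' i = s i)"
  shows "polytime f"
proof -
  obtain p where p: "\<And>t. T t \<le> poly p (size t)"
    using assms(1) unfolding poly_bounded_def by blast
  have "realizes c N p f"
    unfolding realizes_def using assms(2) runs_mono[OF _ p] by blast
  then show ?thesis unfolding polytime_def by blast
qed

text \<open>Output size is at most input size plus running time. This is what makes composition
  work: the second program is polynomial in the size of an intermediate result.\<close>

lemma polytime_poly_bounded:
  assumes "polytime f"
  shows "poly_bounded (\<lambda>t. size (f t))"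
proof -
  obtain c N b where c: "realizes c N b f" using assms unfolding polytime_def by blast
  have "size (f t) \<le> size t + poly b (size t)" for t
  proof -
    \<comment> \<open>Any start state with \<open>t\<close> in variable 0 will do, because
      \<open>realizes\<close> quantifies over all of them.\<close>
    obtain s' where "runs c (\<lambda>_. t) (poly b (size t)) s'" "s' 0 = f t"
      using realizesD[OF c, of "\<lambda>_. t"] by metis
    then show ?thesis using runs_size_le[of c "\<lambda>_. t" _ s' 0] by simp
  qed
  then show ?thesis
    by (rule poly_bounded_le[rotated]) (intro poly_bounded_intros poly_bounded_size)
qed

text \<open>The second hypothesis says that the cost depends on variable 0 alone, hence it can be
  bounded as a function of the input tree.\<close>

lemma polytime_expr:
  assumes "poly_bounded (\<lambda>t. eval_cost e ((\<lambda>_. Leaf)(0 := t)))"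
    and "\<And>s. eval_cost e s = eval_cost e ((\<lambda>_. Leaf)(0 := s 0))"
    and "\<And>s. eval e s = f (s 0)"
  shows "polytime f"
proof (rule polytimeI[where c = "Assign 0 e" and N = 1])
  show "poly_bounded (\<lambda>t. 1 + eval_cost e ((\<lambda>_. Leaf)(0 := t)))"
    by (intro poly_bounded_intros assms)
  show "\<exists>s'. runs (Assign 0 e) s (1 + eval_cost e ((\<lambda>_. Leaf)(0 := s 0))) s' \<and>
      s' 0 = f (s 0) \<and> (\<forall>i\<ge>1. s' i = s i)" for s
    using runs_Assign[of 0 e s] assms(2)[of s] assms(3)[of s]
    by (intro exI[of _ "s(0 := f (s 0))"]) auto
qed

lemma polytime_id: "polytime (\<lambda>t. t)"
proof (rule polytime_expr[where e = "Var 0"])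
  show "poly_bounded (\<lambda>t. eval_cost (Var 0) ((\<lambda>_. Leaf)(0 := t)))"
    by (rule poly_bounded_le[of "\<lambda>t. 1 + size t"]) (intro poly_bounded_intros poly_bounded_size, simp)
qed auto

lemma size_left_subtree: "size (left_subtree t) \<le> size t"
  by (cases t) auto

lemma size_right_subtree: "size (right_subtree t) \<le> size t"
  by (cases t) auto

section \<open>Composition, pairing, tests and branching\<close>

lemma polytime_comp:
  assumes "polytime f" "polytime g"
  shows "polytime (\<lambda>t. f (g t))"
proof -
  obtain c N b where c: "realizes c N b f" using assms unfolding polytime_def by blast
  obtain d M b' where d: "realizes d M b' g" using assms unfolding polytime_def by blast
  show ?thesis
  proof (rule polytimeI[where c = "Seq d c" and N = "max M N"])
    show "poly_bounded (\<lambda>t. 1 + poly b' (size t) + poly b (size (g t)))"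
      by (intro poly_bounded_intros poly_bounded_size polytime_poly_bounded assms)
    fix s :: state
    obtain s1 where s1: "runs d s (poly b' (size (s 0))) s1" "s1 0 = g (s 0)"
      "\<And>i. i \<ge> M \<Longrightarrow> s1 i = s i" using realizesD[OF d] by blast
    obtain s2 where s2: "runs c s1 (poly b (size (s1 0))) s2" "s2 0 = f (s1 0)"
      "\<And>i. i \<ge> N \<Longrightarrow> s2 i = s1 i" using realizesD[OF c] by blast
    show "\<exists>s'. runs (Seq d c) s (1 + poly b' (size (s 0)) + poly b (size (g (s 0)))) s' \<and>
        s' 0 = f (g (s 0)) \<and> (\<forall>i\<ge>max M N. s' i = s i)"
      using runs_Seq[OF s1(1) s2(1)] s1 s2 by auto
  qed
qed

lemma polytime_left: "polytime f \<Longrightarrow> polytime (\<lambda>t. left_subtree (f t))"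
proof (rule polytime_comp[of left_subtree])
  show "polytime left_subtree"
  proof (rule polytime_expr[where e = "Left_Of (Var 0)"])
    show "poly_bounded (\<lambda>t. eval_cost (Left_Of (Var 0)) ((\<lambda>_. Leaf)(0 := t)))"
      by (rule poly_bounded_le[of "\<lambda>t. 2 + (size t + size t)"])
         (intro poly_bounded_intros poly_bounded_size, simp add: size_left_subtree)
  qed auto
qed

lemma polytime_right: "polytime f \<Longrightarrow> polytime (\<lambda>t. right_subtree (f t))"
proof (rule polytime_comp[of right_subtree])
  show "polytime right_subtree"
  proof (rule polytime_expr[where e = "Right_Of (Var 0)"])
    show "poly_bounded (\<lambda>t. eval_cost (Right_Of (Var 0)) ((\<lambda>_. Leaf)(0 := t)))"
      by (rule poly_bounded_le[of "\<lambda>t. 2 + (size t + size t)"])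
         (intro poly_bounded_intros poly_bounded_size, simp add: size_right_subtree)
  qed auto
qed

lemma polytime_Branch:
  assumes "polytime f" "polytime g"
  shows "polytime (\<lambda>t. Branch (f t) (g t))"
proof -
  obtain c N b where c: "realizes c N b f" using assms unfolding polytime_def by blast
  obtain d M b' where d: "realizes d M b' g" using assms unfolding polytime_def by blast
  \<comment> \<open>Both programs leave variables from \<open>K\<close> on alone, and
    \<open>Suc\<close> keeps \<open>K\<close> apart from variable 0. The input survives the first
    call in \<open>K\<close>, the first result survives the second call in
    \<open>Suc K\<close>.\<close>
  define K where "K = Suc (max M N)"
  let ?e = "Mk_Branch (Var (Suc K)) (Var 0)"
  let ?P = "Seq (Assign K (Var 0)) (Seq c (Seq (Assign (Suc K) (Var 0)) (Seq (Assign 0 (Var K))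
    (Seq d (Assign 0 ?e)))))"
  let ?T = "\<lambda>t. 20 + (2 * size t + poly b (size t) + poly b' (size t) +
    (3 * size (f t) + 2 * size (g t)))"
  show ?thesis
  proof (rule polytimeI[where c = ?P and N = "K + 2"])
    show "poly_bounded ?T"
      by (intro poly_bounded_intros poly_bounded_size polytime_poly_bounded assms)
    fix s :: state
    let ?s1 = "s(K := s 0)"
    have r1: "runs (Assign K (Var 0)) s (2 + size (s 0)) ?s1"
      using runs_Assign[of K "Var 0" s] by simp
    obtain s2 where s2: "runs c ?s1 (poly b (size (?s1 0))) s2" "s2 0 = f (?s1 0)"
      "\<And>i. i \<ge> N \<Longrightarrow> s2 i = ?s1 i" using realizesD[OF c] by blast
    let ?s3 = "s2(Suc K := s2 0)"
    have r3: "runs (Assign (Suc K) (Var 0)) s2 (2 + size (f (s 0))) ?s3"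
      using runs_Assign[of "Suc K" "Var 0" s2] s2(2) by (simp add: K_def)
    let ?s4 = "?s3(0 := ?s3 K)"
    have K: "?s3 K = s 0" using s2(3)[of K] by (simp add: K_def)
    have r4: "runs (Assign 0 (Var K)) ?s3 (2 + size (s 0)) ?s4"
      using runs_Assign[of 0 "Var K" ?s3] K by simp
    obtain s5 where s5: "runs d ?s4 (poly b' (size (?s4 0))) s5" "s5 0 = g (?s4 0)"
      "\<And>i. i \<ge> M \<Longrightarrow> s5 i = ?s4 i" using realizesD[OF d] by blast
    have s50: "s5 0 = g (s 0)" using s5(2) K by simp
    have s5K: "s5 (Suc K) = f (s 0)" using s5(3)[of "Suc K"] s2(2) by (simp add: K_def)
    let ?s6 = "s5(0 := Branch (f (s 0)) (g (s 0)))"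
    have r6: "runs (Assign 0 ?e) s5 (5 + 2 * size (f (s 0)) + 2 * size (g (s 0))) ?s6"
      using runs_Assign[of 0 ?e s5] s50 s5K
      by (auto elim!: runs_mono)
    have R: "runs ?P s (1 + (2 + size (s 0)) + (1 + poly b (size (s 0)) + (1 + (2 + size (f (s 0))) +
      (1 + (2 + size (s 0)) + (1 + poly b' (size (s 0)) +
        (5 + 2 * size (f (s 0)) + 2 * size (g (s 0)))))))) ?s6"
      using s2(1) s5(1) K
      by (intro runs_Seq[OF r1] runs_Seq[OF _ runs_Seq[OF r3 runs_Seq[OF r4 runs_Seq[OF _ r6]]]])
         (auto simp: K_def)
    have "runs ?P s (?T (s 0)) ?s6"
      by (rule runs_mono[OF R]) simp
    moreover have "?s6 i = s i" if "i \<ge> K + 2" for i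
      using that s5(3)[of i] s2(3)[of i] by (simp add: K_def)
    ultimately show "\<exists>s'. runs ?P s (?T (s 0)) s' \<and> s' 0 = Branch (f (s 0)) (g (s 0)) \<and>
        (\<forall>i\<ge>K + 2. s' i = s i)"
      by (intro exI[of _ ?s6]) auto
  qed
qed

lemma polytime_const: "polytime (\<lambda>_. t)"
proof (induction t)
  case Leaf
  show ?case
    by (rule polytime_expr[where e = Const_Leaf])
       (auto simp flip: One_nat_def intro: poly_bounded_const)
qed (rule polytime_Branch)

lemma polytime_eq:
  assumes "polytime f" "polytime g"
  shows "polytime (\<lambda>t. bool_tree (f t = g t))"
proof -
  \<comment> \<open>Both values are first paired in variable 0, so that a single expression over
    that variable can compare them.\<close>
  let ?e = "Test_Eq (Left_Of (Var 0)) (Right_Of (Var 0))"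
  have "polytime (\<lambda>w. bool_tree (left_subtree w = right_subtree w))"
  proof (rule polytime_expr[where e = ?e])
    have "eval_cost ?e ((\<lambda>_. Leaf)(0 := t)) \<le> 6 + 4 * size t" for t
      using size_left_subtree[of t] size_right_subtree[of t] by (auto simp: bool_tree_def)
    then show "poly_bounded (\<lambda>t. eval_cost ?e ((\<lambda>_. Leaf)(0 := t)))"
      by (rule poly_bounded_le[rotated]) (intro poly_bounded_intros poly_bounded_size)
  qed auto
  from polytime_comp[OF this polytime_Branch[OF assms]] show ?thesis by simp
qed

lemma polytime_if:
  assumes "polytime (\<lambda>t. bool_tree (P t))" "polytime f" "polytime g"
  shows "polytime (\<lambda>t. if P t then f t else g t)"
proof -
  obtain a L r where a: "realizes a L r (\<lambda>t. bool_tree (P t))"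
    using assms unfolding polytime_def by blast
  obtain c N b where c: "realizes c N b f" using assms unfolding polytime_def by blast
  obtain d M b' where d: "realizes d M b' g" using assms unfolding polytime_def by blast
  define K where "K = Suc (max L (max M N))"
  let ?R = "Assign 0 (Var K)"
  let ?I = "If_Branch (Var 0) (Seq ?R c) (Seq ?R d)"
  let ?P = "Seq (Assign K (Var 0)) (Seq a ?I)"
  let ?T = "\<lambda>t. 20 + (2 * size t + poly r (size t) + poly b (size t) + poly b' (size t))"
  show ?thesis
  proof (rule polytimeI[where c = ?P and N = "K + 1"])
    show "poly_bounded ?T"
      by (intro poly_bounded_intros poly_bounded_size)
    fix s :: state
    let ?s1 = "s(K := s 0)"
    have r1: "runs (Assign K (Var 0)) s (2 + size (s 0)) ?s1"
      using runs_Assign[of K "Var 0" s] by simp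
    obtain s2 where s2: "runs a ?s1 (poly r (size (?s1 0))) s2" "s2 0 = bool_tree (P (?s1 0))"
      "\<And>i. i \<ge> L \<Longrightarrow> s2 i = ?s1 i" using realizesD[OF a] by blast
    let ?s3 = "s2(0 := s2 K)"
    have K: "s2 K = s 0" using s2(3)[of K] by (simp add: K_def)
    have r3: "runs ?R s2 (2 + size (s 0)) ?s3"
      using runs_Assign[of 0 "Var K" s2] K by simp
    obtain s4 where s4: "runs c ?s3 (poly b (size (?s3 0))) s4" "s4 0 = f (?s3 0)"
      "\<And>i. i \<ge> N \<Longrightarrow> s4 i = ?s3 i" using realizesD[OF c] by blast
    obtain s5 where s5: "runs d ?s3 (poly b' (size (?s3 0))) s5" "s5 0 = g (?s3 0)"
      "\<And>i. i \<ge> M \<Longrightarrow> s5 i = ?s3 i" using realizesD[OF d] by blast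
    let ?s6 = "if P (s 0) then s4 else s5"
    have e: "eval (Var 0) s2 \<noteq> Leaf \<longleftrightarrow> P (s 0)"
      using s2(2) by (simp add: K_def bool_tree_def)
    have cost: "eval_cost (Var 0) s2 \<le> 2"
      using s2(2) by (simp add: K_def bool_tree_def)
    \<comment> \<open>The bound adds the times of both branches and so does not depend on the one
      taken.\<close>
    have r6: "runs ?I s2 (1 + eval_cost (Var 0) s2 + (1 + (2 + size (s 0)) +
        (poly b (size (s 0)) + poly b' (size (s 0))))) ?s6"
    proof (rule runs_If, cases "P (s 0)")
      case True
      have "runs (Seq ?R c) s2 (1 + (2 + size (s 0)) + poly b (size (s 0))) s4"
        using s4(1) K by (intro runs_Seq[OF r3]) auto
      from runs_mono[OF this]
      show "runs (if eval (Var 0) s2 \<noteq> Leaf then Seq ?R c else Seq ?R d) s2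
          (1 + (2 + size (s 0)) + (poly b (size (s 0)) + poly b' (size (s 0)))) ?s6"
        using e True by simp
    next
      case False
      have "runs (Seq ?R d) s2 (1 + (2 + size (s 0)) + poly b' (size (s 0))) s5"
        using s5(1) K by (intro runs_Seq[OF r3]) auto
      from runs_mono[OF this]
      show "runs (if eval (Var 0) s2 \<noteq> Leaf then Seq ?R c else Seq ?R d) s2
          (1 + (2 + size (s 0)) + (poly b (size (s 0)) + poly b' (size (s 0)))) ?s6"
        using e False by simp
    qed
    have R: "runs ?P s (1 + (2 + size (s 0)) + (1 + poly r (size (s 0)) +
        (1 + eval_cost (Var 0) s2 + (1 + (2 + size (s 0)) +
        (poly b (size (s 0)) + poly b' (size (s 0))))))) ?s6"
      using s2(1) by (intro runs_Seq[OF r1 runs_Seq[OF _ r6]]) (simp add: K_def)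
    have "runs ?P s (?T (s 0)) ?s6"
      by (rule runs_mono[OF R]) (use cost in simp)
    moreover have "?s6 i = s i" if "i \<ge> K + 1" for i
      using that s5(3)[of i] s2(3)[of i] s4(3)[of i] by (simp add: K_def)
    moreover have "?s6 0 = (if P (s 0) then f (s 0) else g (s 0))"
      using s4(2) s5(2) K by simp
    ultimately show "\<exists>s'. runs ?P s (?T (s 0)) s' \<and> s' 0 = (if P (s 0) then f (s 0) else g (s 0)) \<and>
        (\<forall>i\<ge>K + 1. s' i = s i)"
      by blast
  qed
qed

section \<open>Lists as trees\<close>

fun tree_list :: "tree \<Rightarrow> tree list" where
  "tree_list Leaf = []"
| "tree_list (Branch a b) = a # tree_list b"

lemma list_tree_tree_list [simp]: "list_tree (tree_list t) = t"
  by (induction t) auto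

lemma tree_list_list_tree [simp]: "tree_list (list_tree xs) = xs"
  by (induction xs) auto

lemma size_tree_list: "size t = (\<Sum>x\<leftarrow>tree_list t. Suc (size x))"
  by (induction t) auto

lemma size_list_tree: "size (list_tree xs) = (\<Sum>x\<leftarrow>xs. Suc (size x))"
  using size_tree_list[of "list_tree xs"] by simp

lemma length_tree_list: "length (tree_list t) \<le> size t"
  by (induction t) auto

lemma size_tree_list_elem: "x \<in> set (tree_list t) \<Longrightarrow> size x \<le> size t"
  by (induction t) auto

text \<open>Variable \<open>K\<close> holds the context, \<open>K + 1\<close> the rest of the list
  and \<open>K + 2\<close> the accumulator. \<open>W\<close> bounds the data at every prefix
  \<open>ys\<close> of the list, hence each iteration costs at most the same fixed amount; the
  induction follows the remaining list.\<close>

lemma runs_fold_loop: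
  fixes s :: state and e :: "tree list \<Rightarrow> tree"
  assumes c: "realizes c N b (\<lambda>w. g (left_subtree w) (left_subtree (right_subtree w))
      (right_subtree (right_subtree w)))"
    and N: "K \<ge> N" "K > 0"
    and W: "\<And>ys zs. tree_list (s (K + 1)) = ys @ zs \<Longrightarrow>
      size (s K) + size (s (K + 1)) + size (fold (g (s K)) ys (s (K + 2))) \<le> W"
  shows "\<exists>s'. runs (While_Branch (Var (K + 1))
      (Seq (Assign 0 (Mk_Branch (Var K) (Mk_Branch (Left_Of (Var (K + 1))) (Var (K + 2)))))
      (Seq c (Seq (Assign (K + 2) (Var 0)) (Assign (K + 1) (Right_Of (Var (K + 1))))))))
      s (Suc (length (tree_list (s (K + 1)))) * (20 * W + 30 + poly b (2 * W + 2))) s' \<and>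
    s' (K + 2) = fold (g (s K)) (tree_list (s (K + 1))) (s (K + 2)) \<and>
    (\<forall>i\<ge>K + 3. s' i = s i)"
  using W
proof (induction "s (K + 1)" arbitrary: s)
  case Leaf
  note Leaf_eq = \<open>Leaf = s (K + 1)\<close>[symmetric]
  have "runs (While_Branch (Var (K + 1)) d) s (1 + eval_cost (Var (K + 1)) s) s" for d
    using Leaf_eq by (intro runs_While_False) simp
  from runs_mono[OF this] show ?case
    using Leaf_eq by (intro exI[of _ s]) simp
next
  case (Branch x xs)
  note B = \<open>Branch x xs = s (K + 1)\<close>[symmetric]
  let ?a = "s (K + 2)" and ?t = "s K"
  let ?a' = "g ?t x ?a"
  let ?C = "20 * W + 30 + poly b (2 * W + 2)"
  let ?e = "Mk_Branch (Var K) (Mk_Branch (Left_Of (Var (K + 1))) (Var (K + 2)))"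
  let ?d = "Seq (Assign 0 ?e) (Seq c (Seq (Assign (K + 2) (Var 0))
    (Assign (K + 1) (Right_Of (Var (K + 1))))))"
  let ?s1 = "s(0 := Branch ?t (Branch x ?a))"
  \<comment> \<open>The empty prefix bounds the data before the iteration, the prefix
    \<open>[x]\<close> the data with the new accumulator.\<close>
  have W0: "size ?t + size x + size xs + 1 + size ?a \<le> W"
    using Branch.prems[of "[]" "tree_list (s (K + 1))"] B by simp
  have W1: "size ?t + size x + size xs + 1 + size ?a' \<le> W"
    using Branch.prems[of "[x]" "tree_list xs"] B by simp
  have r1: "runs (Assign 0 ?e) s (1 + eval_cost ?e s) ?s1"
    using runs_Assign[of 0 ?e s] B by simp
  obtain s2 where s2: "runs c ?s1 (poly b (size (?s1 0))) s2" "s2 0 = ?a'"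
      "\<And>i. i \<ge> N \<Longrightarrow> s2 i = ?s1 i"
    using realizesD[OF c, of ?s1] by auto
  let ?s3 = "s2(K + 2 := ?a')"
  have r3: "runs (Assign (K + 2) (Var 0)) s2 (2 + size ?a') ?s3"
    using runs_Assign[of "K + 2" "Var 0" s2] s2(2) by simp
  let ?s4 = "?s3(K + 1 := xs)"
  have s3K: "?s3 (K + 1) = Branch x xs"
    using s2(3)[of "K + 1"] N B by simp
  have r4: "runs (Assign (K + 1) (Right_Of (Var (K + 1)))) ?s3
      (1 + eval_cost (Right_Of (Var (K + 1))) ?s3) ?s4"
    using runs_Assign[of "K + 1" "Right_Of (Var (K + 1))" ?s3] s3K by simp
  have c4: "eval_cost (Right_Of (Var (K + 1))) ?s3 \<le> 5 + 2 * W"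
    using s3K W0 by simp
  have c1: "eval_cost ?e s \<le> 10 + 10 * W"
    using W0 B by simp
  have p: "poly b (size (?s1 0)) \<le> poly b (2 * W + 2)"
    by (rule poly_nat_mono) (use W0 in simp)
  have s4: "?s4 K = ?t" "?s4 (K + 1) = xs" "?s4 (K + 2) = ?a'"
    using s2(3)[of K] N by auto
  have "\<exists>s'. runs (While_Branch (Var (K + 1)) ?d) ?s4
      (Suc (length (tree_list (?s4 (K + 1)))) * ?C) s' \<and>
    s' (K + 2) = fold (g (?s4 K)) (tree_list (?s4 (K + 1))) (?s4 (K + 2)) \<and>
    (\<forall>i\<ge>K + 3. s' i = ?s4 i)"
  proof (rule Branch.hyps(2))
    show "xs = ?s4 (K + 1)" by simp
    fix ys zs assume "tree_list (?s4 (K + 1)) = ys @ zs"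
    then have "tree_list (s (K + 1)) = (x # ys) @ zs" using B s4 by simp
    from Branch.prems[OF this]
    show "size (?s4 K) + size (?s4 (K + 1)) + size (fold (g (?s4 K)) ys (?s4 (K + 2))) \<le> W"
      unfolding s4 using B by simp
  qed
  then obtain s' where s': "runs (While_Branch (Var (K + 1)) ?d) ?s4
      (Suc (length (tree_list xs)) * ?C) s'"
    "s' (K + 2) = fold (g ?t) (tree_list xs) ?a'" "\<And>i. i \<ge> K + 3 \<Longrightarrow> s' i = ?s4 i"
    unfolding s4 by blast
  have "runs ?d s (1 + (1 + eval_cost ?e s) + (1 + poly b (size (?s1 0)) + (1 + (2 + size ?a') +
      (1 + eval_cost (Right_Of (Var (K + 1))) ?s3)))) ?s4"
    by (intro runs_Seq[OF r1 runs_Seq[OF s2(1) runs_Seq[OF r3 r4]]])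
  then have "runs ?d s (30 + 15 * W + poly b (2 * W + 2)) ?s4"
    by (rule runs_mono) (use c1 c4 p W1 in linarith)
  then have "runs (While_Branch (Var (K + 1)) ?d) s (1 + eval_cost (Var (K + 1)) s +
      (30 + 15 * W + poly b (2 * W + 2)) + Suc (length (tree_list xs)) * ?C) s'"
    by (intro runs_While_True[OF _ _ s'(1)]) (use B in simp)
  then have "runs (While_Branch (Var (K + 1)) ?d) s
      (Suc (length (tree_list (s (K + 1)))) * ?C) s'"
    by (rule runs_mono) (use B W0 in simp)
  moreover have "s' i = s i" if "i \<ge> K + 3" for i
    using that s'(3)[of i] s2(3)[of i] N by simp
  ultimately show ?case
    using s'(2) B by (intro exI[of _ s']) simp
qed

text \<open>The accumulators are bounded by an external function \<open>p\<close>, not by the growth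
  of a single step. Elimination relies on this form, since its size bound comes from an invariant.
  The step is a function of the triple \<open>Branch t (Branch x a)\<close>.\<close>

lemma polytime_fold_bounded:
  assumes g: "polytime (\<lambda>w. g (left_subtree w) (left_subtree (right_subtree w))
      (right_subtree (right_subtree w)))"
    and h: "polytime h" and i: "polytime i"
    and p: "poly_bounded p"
    and bound: "\<And>t ys zs. tree_list (h t) = ys @ zs \<Longrightarrow> size (fold (g t) ys (i t)) \<le> p t"
  shows "polytime (\<lambda>t. fold (g t) (tree_list (h t)) (i t))"
proof -
  let ?in = "\<lambda>t. Branch t (Branch (h t) (i t))"
  obtain c N b where c: "realizes c N b (\<lambda>w. g (left_subtree w) (left_subtree (right_subtree w))
      (right_subtree (right_subtree w)))" using g unfolding polytime_def by blast
  have in_pt: "polytime ?in" by (intro polytime_Branch polytime_id h i)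
  obtain d M b' where d: "realizes d M b' ?in" using in_pt unfolding polytime_def by blast
  define K where "K = Suc (max M N)"
  let ?L = "Left_Of (Var 0)" and ?R = "Left_Of (Right_Of (Var 0))"
    and ?A = "Right_Of (Right_Of (Var 0))"
  let ?loop = "While_Branch (Var (K + 1))
      (Seq (Assign 0 (Mk_Branch (Var K) (Mk_Branch (Left_Of (Var (K + 1))) (Var (K + 2)))))
      (Seq c (Seq (Assign (K + 2) (Var 0)) (Assign (K + 1) (Right_Of (Var (K + 1)))))))"
  let ?P = "Seq d (Seq (Assign K ?L) (Seq (Assign (K + 1) ?R) (Seq (Assign (K + 2) ?A)
    (Seq ?loop (Assign 0 (Var (K + 2)))))))"
  let ?W = "\<lambda>t. size t + size (h t) + p t"
  let ?T = "\<lambda>t. 50 + (poly b' (size t) + 20 * size (?in t) +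
    (1 + size (h t)) * (20 * ?W t + 30 + poly b (2 * ?W t + 2)) + p t)"
  show ?thesis
  proof (rule polytimeI[where c = ?P and N = "K + 3"])
    show "poly_bounded ?T"
      by (intro poly_bounded_intros poly_bounded_size polytime_poly_bounded[OF in_pt]
          polytime_poly_bounded[OF h] p)
    fix s :: state
    let ?t = "s 0"
    obtain s1 where s1: "runs d s (poly b' (size ?t)) s1" "s1 0 = ?in ?t"
      "\<And>i. i \<ge> M \<Longrightarrow> s1 i = s i" using realizesD[OF d] by blast
    let ?s2 = "s1(K := ?t)"
    let ?s3 = "?s2(K + 1 := h ?t)"
    let ?s4 = "?s3(K + 2 := i ?t)"
    have zero: "s1 0 = ?in ?t" "?s2 0 = ?in ?t" "?s3 0 = ?in ?t"
      using s1(2) by (auto simp: K_def)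
    have r2: "runs (Assign K ?L) s1 (1 + eval_cost ?L s1) ?s2"
      using runs_Assign[of K ?L s1] zero by simp
    have r3: "runs (Assign (K + 1) ?R) ?s2 (1 + eval_cost ?R ?s2) ?s3"
      using runs_Assign[of "K + 1" ?R ?s2] zero by simp
    have r4: "runs (Assign (K + 2) ?A) ?s3 (1 + eval_cost ?A ?s3) ?s4"
      using runs_Assign[of "K + 2" ?A ?s3] zero by simp
    have costs: "eval_cost ?L s1 \<le> 5 + 5 * size (?in ?t)" "eval_cost ?R ?s2 \<le> 5 + 5 * size (?in ?t)"
      "eval_cost ?A ?s3 \<le> 5 + 5 * size (?in ?t)"
      using zero by (simp_all add: K_def)
    have s4: "?s4 K = ?t" "?s4 (K + 1) = h ?t" "?s4 (K + 2) = i ?t" by auto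
    have "\<exists>s'. runs ?loop ?s4 (Suc (length (tree_list (?s4 (K + 1)))) *
        (20 * ?W ?t + 30 + poly b (2 * ?W ?t + 2))) s' \<and>
      s' (K + 2) = fold (g (?s4 K)) (tree_list (?s4 (K + 1))) (?s4 (K + 2)) \<and>
      (\<forall>i\<ge>K + 3. s' i = ?s4 i)"
      by (rule runs_fold_loop[OF c]) (use bound in \<open>auto simp: K_def\<close>)
    then obtain s5 where s5: "runs ?loop ?s4 (Suc (length (tree_list (h ?t))) *
        (20 * ?W ?t + 30 + poly b (2 * ?W ?t + 2))) s5"
      "s5 (K + 2) = fold (g ?t) (tree_list (h ?t)) (i ?t)" "\<And>i. i \<ge> K + 3 \<Longrightarrow> s5 i = ?s4 i"
      unfolding s4 by blast
    have r5: "runs ?loop ?s4 ((1 + size (h ?t)) * (20 * ?W ?t + 30 + poly b (2 * ?W ?t + 2))) s5"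
      by (rule runs_mono[OF s5(1)]) (intro mult_right_mono, auto simp: length_tree_list)
    let ?s6 = "s5(0 := s5 (K + 2))"
    have r6: "runs (Assign 0 (Var (K + 2))) s5 (1 + eval_cost (Var (K + 2)) s5) ?s6"
      using runs_Assign[of 0 "Var (K + 2)" s5] by simp
    have c6: "eval_cost (Var (K + 2)) s5 \<le> 1 + p ?t"
      using s5(2) bound[of ?t "tree_list (h ?t)" "[]"] by simp
    have "runs ?P s (1 + poly b' (size ?t) + (1 + (1 + eval_cost ?L s1) +
        (1 + (1 + eval_cost ?R ?s2) + (1 + (1 + eval_cost ?A ?s3) + (1 +
        (1 + size (h ?t)) * (20 * ?W ?t + 30 + poly b (2 * ?W ?t + 2)) +
        (1 + eval_cost (Var (K + 2)) s5)))))) ?s6"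
      by (intro runs_Seq[OF s1(1) runs_Seq[OF r2 runs_Seq[OF r3 runs_Seq[OF r4
        runs_Seq[OF r5 r6]]]]])
    then have "runs ?P s (?T ?t) ?s6"
      by (rule runs_mono) (use costs c6 in linarith)
    moreover have "?s6 i = s i" if "i \<ge> K + 3" for i
      using that s5(3)[of i] s1(3)[of i] by (simp add: K_def)
    ultimately show "\<exists>s'. runs ?P s (?T ?t) s' \<and>
        s' 0 = fold (g ?t) (tree_list (h ?t)) (i ?t) \<and> (\<forall>i\<ge>K + 3. s' i = s i)"
      using s5(2) by (intro exI[of _ ?s6]) auto
  qed
qed

lemma size_fold_le:
  assumes "\<And>x a. x \<in> set xs \<Longrightarrow> size (f x a) \<le> size a + B"
  shows "size (fold f xs (a :: tree)) \<le> size a + length xs * B"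
  using assms
proof (induction xs arbitrary: a)
  case (Cons x xs)
  have "size (fold f xs (f x a)) \<le> size (f x a) + length xs * B"
    using Cons by simp
  also have "size (f x a) \<le> size a + B" using Cons.prems by simp
  finally show ?case by simp
qed simp

text \<open>
  The accumulator may grow only additively: with a step that, say, doubles its size, the loop would
  take exponential time.
\<close>

lemma polytime_fold:
  assumes g: "polytime (\<lambda>w. g (left_subtree w) (left_subtree (right_subtree w))
      (right_subtree (right_subtree w)))"
    and h: "polytime h" and i: "polytime i"
    and bound: "\<And>t x a. size (g t x a) \<le> size a + poly p (size t + size x)"
  shows "polytime (\<lambda>t. fold (g t) (tree_list (h t)) (i t))"
proof (rule polytime_fold_bounded[OF g h i])
  let ?p = "\<lambda>t. size (i t) + size (h t) * poly p (size t + size (h t))"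
  show "poly_bounded ?p"
    by (intro poly_bounded_intros poly_bounded_size polytime_poly_bounded h i)
  fix t ys zs assume *: "tree_list (h t) = ys @ zs"
  let ?B = "poly p (size t + size (h t))"
  have "size (g t x a) \<le> size a + ?B" if "x \<in> set ys" for x a
  proof -
    have "size x \<le> size (h t)" using that * by (intro size_tree_list_elem) simp
    then have "poly p (size t + size x) \<le> ?B" by (intro poly_nat_mono) simp
    then show ?thesis using bound[of t x a] by linarith
  qed
  from size_fold_le[of ys "g t", OF this]
  have "size (fold (g t) ys (i t)) \<le> size (i t) + length ys * ?B" by blast
  also have "length ys \<le> size (h t)"
    using length_tree_list[of "h t"] * by simp
  finally show "size (fold (g t) ys (i t)) \<le> ?p t" by simp
qed

lemmas polytime_basic = polytime_const polytime_id polytime_left polytime_right polytime_Branch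

lemma polytime_comp2:
  assumes "polytime (\<lambda>w. F (left_subtree w) (right_subtree w))" "polytime f" "polytime g"
  shows "polytime (\<lambda>t. F (f t) (g t))"
  using polytime_comp[OF assms(1) polytime_Branch[OF assms(2,3)]] by simp

section \<open>List operations in polynomial time\<close>

lemma polytime_rev:
  assumes "polytime h"
  shows "polytime (\<lambda>t. list_tree (rev (tree_list (h t))))"
proof -
  have "polytime (\<lambda>t. fold (\<lambda>x a. Branch x a) (tree_list (h t)) Leaf)"
    by (rule polytime_fold[where g = "\<lambda>t x a. Branch x a" and p = "[:1, 1:]"])
       (intro polytime_basic assms | simp)+
  moreover have "fold (\<lambda>x a. Branch x a) xs a = list_tree (rev xs @ tree_list a)" for xs a
    by (induction xs arbitrary: a) auto
  ultimately show ?thesis by simp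
qed

text \<open>Consing the reversed first list onto the second one adds only one element per step, as
  the fold rule demands.\<close>

lemma polytime_append:
  assumes "polytime h" "polytime i"
  shows "polytime (\<lambda>t. list_tree (tree_list (h t) @ tree_list (i t)))"
proof -
  have "polytime (\<lambda>t. fold (\<lambda>x a. Branch x a)
      (tree_list (list_tree (rev (tree_list (h t))))) (i t))"
    by (rule polytime_fold[where g = "\<lambda>t x a. Branch x a" and p = "[:1, 1:]"])
       (intro polytime_basic polytime_rev assms | simp)+
  moreover have "fold (\<lambda>x a. Branch x a) xs a = list_tree (rev xs @ tree_list a)" for xs a
    by (induction xs arbitrary: a) auto
  ultimately show ?thesis by simp
qed

text \<open>The list is traversed backwards and each image is put in front of the accumulator, so a
  step adds the size of \<open>f t x\<close> and nothing that depends on the accumulator.\<close>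

lemma polytime_concat_map:
  assumes f: "polytime (\<lambda>w. f (left_subtree w) (right_subtree w))" and h: "polytime h"
  shows "polytime (\<lambda>t. list_tree (concat (map (\<lambda>x. tree_list (f t x)) (tree_list (h t)))))"
proof -
  obtain p where p: "\<And>w. size (f (left_subtree w) (right_subtree w)) \<le> poly p (size w)"
    using polytime_poly_bounded[OF f] unfolding poly_bounded_def by blast
  have "polytime (\<lambda>t. fold (\<lambda>x a. list_tree (tree_list (f t x) @ tree_list a))
      (tree_list (list_tree (rev (tree_list (h t))))) Leaf)"
  proof (rule polytime_fold[where p = "pcompose p [:1, 1:]"])
    show "polytime (\<lambda>w. list_tree (tree_list (f (left_subtree w) (left_subtree (right_subtree w))) @
        tree_list (right_subtree (right_subtree w))))"
      by (intro polytime_append polytime_basic polytime_comp2[OF f])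
    show "size (list_tree (tree_list (f t x) @ tree_list a)) \<le>
        size a + poly (pcompose p [:1, 1:]) (size t + size x)" for t x a
      using p[of "Branch t x"]
      by (simp add: poly_pcompose size_list_tree size_tree_list[of a] size_tree_list[of "f t x"])
  qed (intro polytime_basic polytime_rev h)+
  moreover have "fold (\<lambda>x a. list_tree (tree_list (f t x) @ tree_list a)) xs a =
      list_tree (concat (map (\<lambda>x. tree_list (f t x)) (rev xs)) @ tree_list a)" for t xs a
    by (induction xs arbitrary: a) auto
  ultimately show ?thesis by simp
qed

lemma polytime_map:
  assumes f: "polytime (\<lambda>w. f (left_subtree w) (right_subtree w))" and h: "polytime h"
  shows "polytime (\<lambda>t. list_tree (map (f t) (tree_list (h t))))"
proof -
  have "polytime (\<lambda>t. list_tree (concat (map (\<lambda>x. tree_list (Branch (f t x) Leaf))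
      (tree_list (h t)))))"
    by (rule polytime_concat_map) (intro polytime_basic f h)+
  moreover have "concat (map (\<lambda>x. tree_list (Branch (f t x) Leaf)) xs) = map (f t) xs" for t xs
    by (induction xs) auto
  ultimately show ?thesis by simp
qed

lemma polytime_filter:
  assumes f: "polytime (\<lambda>w. bool_tree (P (left_subtree w) (right_subtree w)))" and h: "polytime h"
  shows "polytime (\<lambda>t. list_tree (filter (P t) (tree_list (h t))))"
proof -
  have "polytime (\<lambda>t. list_tree (concat (map (\<lambda>x. tree_list (if P t x then Branch x Leaf else Leaf))
      (tree_list (h t)))))"
    by (rule polytime_concat_map) (intro polytime_if polytime_basic f h)+
  moreover have "concat (map (\<lambda>x. tree_list (if P t x then Branch x Leaf else Leaf)) xs) =
      filter (P t) xs" for t xs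
    by (induction xs) auto
  ultimately show ?thesis by simp
qed

lemma polytime_Not:
  assumes "polytime (\<lambda>t. bool_tree (P t))"
  shows "polytime (\<lambda>t. bool_tree (\<not> P t))"
proof -
  have "polytime (\<lambda>t. if P t then Leaf else Branch Leaf Leaf)"
    by (intro polytime_if polytime_basic assms)
  moreover have "(if P t then Leaf else Branch Leaf Leaf) = bool_tree (\<not> P t)" for t
    by (simp add: bool_tree_def)
  ultimately show ?thesis by simp
qed

lemma polytime_member:
  assumes f: "polytime f" and h: "polytime h"
  shows "polytime (\<lambda>t. bool_tree (f t \<in> set (tree_list (h t))))"
proof -
  have "polytime (\<lambda>t. bool_tree (list_tree (filter (\<lambda>x. x = f t) (tree_list (h t))) \<noteq> Leaf))"
    by (intro polytime_Not polytime_eq polytime_filter polytime_basic h polytime_comp[OF f])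
  moreover have "list_tree (filter (\<lambda>x. x = f t) xs) \<noteq> Leaf \<longleftrightarrow> f t \<in> set xs" for t xs
    by (induction xs) auto
  ultimately show ?thesis by simp
qed

lemmas polytime_intros = polytime_basic polytime_eq polytime_if polytime_Not polytime_append
  polytime_concat_map polytime_map polytime_filter polytime_member

section \<open>Elimination over the two-element field\<close>

text \<open>A vector over the two-element field is the list tree of its support, without repetitions.\<close>

definition toggle :: "tree \<Rightarrow> tree \<Rightarrow> tree" where
  "toggle x v = (if x \<in> set (tree_list v) then list_tree (filter (\<lambda>y. y \<noteq> x) (tree_list v))
     else Branch x v)"

definition xor_tree :: "tree \<Rightarrow> tree \<Rightarrow> tree" where
  "xor_tree b v = fold toggle (tree_list b) v"

definition reduce :: "tree \<Rightarrow> tree \<Rightarrow> tree" where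
  "reduce B v = fold (\<lambda>b v. if left_subtree b \<in> set (tree_list v) then xor_tree b v else v)
     (tree_list B) v"

text \<open>
  The state pairs the reduced vectors with the constraints kept. New vectors go to the end of the
  basis, since \<^const>\<open>reduce\<close> is correct only if no vector contains the pivot of an earlier one.
\<close>

definition elim_step :: "(tree \<Rightarrow> tree) \<Rightarrow> tree \<Rightarrow> tree \<Rightarrow> tree" where
  "elim_step vec x st =
     (let v = reduce (left_subtree st) (xor_tree (vec x) Leaf)
      in if v = Leaf then st
         else Branch (list_tree (tree_list (left_subtree st) @ tree_list (Branch v Leaf)))
           (Branch x (right_subtree st)))"

text \<open>A predicate on indices is a linear functional over the two-element field; this is its
  value at the sum of all entries of \<open>v\<close>, repetitions included.\<close>

definition parity :: "(tree \<Rightarrow> bool) \<Rightarrow> tree \<Rightarrow> bool" where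
  "parity P v \<longleftrightarrow> odd (length (filter P (tree_list v)))"

lemma parity_Leaf [simp]: "\<not> parity P Leaf"
  by (simp add: parity_def)

lemma parity_Branch [simp]: "parity P (Branch x v) \<longleftrightarrow> P x \<noteq> parity P v"
  by (simp add: parity_def)

lemma set_toggle: "set (tree_list (toggle x v)) \<subseteq> insert x (set (tree_list v))"
  by (auto simp: toggle_def)

lemma distinct_toggle: "distinct (tree_list v) \<Longrightarrow> distinct (tree_list (toggle x v))"
  by (auto simp: toggle_def)

lemma mem_toggle: "y \<in> set (tree_list (toggle x v)) \<longleftrightarrow> (y = x) \<noteq> (y \<in> set (tree_list v))"
  by (auto simp: toggle_def)

lemma parity_toggle:
  assumes "distinct (tree_list v)"
  shows "parity P (toggle x v) \<longleftrightarrow> P x \<noteq> parity P v"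
proof (cases "x \<in> set (tree_list v)")
  case False
  then show ?thesis by (simp add: toggle_def)
next
  case True
  then obtain ys zs where v: "tree_list v = ys @ x # zs" by (meson split_list)
  with assms have "x \<notin> set ys" "x \<notin> set zs" by auto
  then have "filter (\<lambda>y. y \<noteq> x) ys = ys" "filter (\<lambda>y. y \<noteq> x) zs = zs"
    by (auto intro!: filter_True)
  then have "filter (\<lambda>y. y \<noteq> x) (tree_list v) = ys @ zs"
    using v by simp
  then show ?thesis using True v by (simp add: toggle_def parity_def)
qed

lemma xor_tree_simps [simp]:
  "xor_tree Leaf v = v" "xor_tree (Branch x b) v = xor_tree b (toggle x v)"
  by (auto simp: xor_tree_def)

lemma set_xor_tree:
  "set (tree_list (xor_tree b v)) \<subseteq> set (tree_list b) \<union> set (tree_list v)"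
  by (induction b arbitrary: v) (use set_toggle in fastforce)+

lemma distinct_xor_tree: "distinct (tree_list v) \<Longrightarrow> distinct (tree_list (xor_tree b v))"
  by (induction b arbitrary: v) (auto simp: distinct_toggle)

lemma parity_xor_tree:
  "distinct (tree_list v) \<Longrightarrow> parity P (xor_tree b v) \<longleftrightarrow> parity P b \<noteq> parity P v"
  by (induction b arbitrary: v) (auto simp: distinct_toggle parity_toggle)

text \<open>An entry repeated in \<open>b\<close> would be toggled twice and cancel, whereas
  \<open>toggle\<close> deletes all copies in \<open>v\<close> at once. For the parity it is the
  other way round: deleting several copies at once could change it wrongly, so there
  \<open>v\<close> is the distinct one.\<close>

lemma mem_xor_tree:
  "distinct (tree_list b) \<Longrightarrow>
    y \<in> set (tree_list (xor_tree b v)) \<longleftrightarrow> (y \<in> set (tree_list b)) \<noteq> (y \<in> set (tree_list v))"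
  by (induction b arbitrary: v) (auto simp: mem_toggle)

lemma reduce_simps [simp]:
  "reduce Leaf v = v"
  "reduce (Branch b B) v =
    reduce B (if left_subtree b \<in> set (tree_list v) then xor_tree b v else v)"
  by (auto simp: reduce_def)

lemma distinct_reduce: "distinct (tree_list v) \<Longrightarrow> distinct (tree_list (reduce B v))"
  by (induction B arbitrary: v) (auto simp: distinct_xor_tree)

lemma set_reduce:
  "set (tree_list (reduce B v)) \<subseteq> set (tree_list v) \<union> (\<Union>b\<in>set (tree_list B). set (tree_list b))"
proof (induction B arbitrary: v)
  case (Branch b B)
  show ?case
    using Branch.IH(2)[of v] Branch.IH(2)[of "xor_tree b v"] set_xor_tree[of b v] by auto
qed simp

lemma parity_reduce:
  assumes "distinct (tree_list v)" "\<forall>b\<in>set (tree_list B). \<not> parity P b"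
  shows "parity P (reduce B v) \<longleftrightarrow> parity P v"
  using assms by (induction B arbitrary: v) (auto simp: distinct_xor_tree parity_xor_tree)

text \<open>Echelon form, the pivot of a vector being the head of its list. Pivots of later vectors
  may occur in earlier ones.\<close>

definition pivoted :: "tree list \<Rightarrow> bool" where
  "pivoted bs \<longleftrightarrow> (\<forall>b\<in>set bs. b \<noteq> Leaf \<and> distinct (tree_list b)) \<and>
     sorted_wrt (\<lambda>b b'. left_subtree b \<notin> set (tree_list b')) bs"

lemma left_subtree_mem: "b \<noteq> Leaf \<Longrightarrow> left_subtree b \<in> set (tree_list b)"
  by (cases b) auto

text \<open>The first step clears the pivot of \<open>b0\<close>, and no later vector contains this
  pivot, so it never returns; the other pivots are handled by recursion.\<close>

lemma pivots_not_in_reduce: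
  assumes "pivoted (tree_list B)" "b \<in> set (tree_list B)"
  shows "left_subtree b \<notin> set (tree_list (reduce B v))"
  using assms
proof (induction B arbitrary: v)
  case (Branch b0 B)
  let ?v = "if left_subtree b0 \<in> set (tree_list v) then xor_tree b0 v else v"
  have piv: "pivoted (tree_list B)" and b0: "b0 \<noteq> Leaf" "distinct (tree_list b0)"
    and not: "\<And>b. b \<in> set (tree_list B) \<Longrightarrow> left_subtree b0 \<notin> set (tree_list b)"
    using Branch.prems by (auto simp: pivoted_def)
  have "left_subtree b0 \<notin> set (tree_list ?v)"
    using left_subtree_mem[OF b0(1)] by (auto simp: mem_xor_tree[OF b0(2)])
  then have "left_subtree b0 \<notin> set (tree_list (reduce B ?v))"
    using set_reduce[of B ?v] not by blast
  then show ?case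
    using Branch.IH(2)[OF piv, of ?v] Branch.prems(2) by auto
qed simp

text \<open>A later vector contains its own pivot but no earlier one. This turns the number of kept
  constraints into a number of distinct indices.\<close>

lemma distinct_pivots: "pivoted bs \<Longrightarrow> distinct (map left_subtree bs)"
proof (induction bs)
  case (Cons b bs)
  then have "left_subtree b \<noteq> left_subtree b'" if "b' \<in> set bs" for b'
    using that left_subtree_mem[of b'] by (auto simp: pivoted_def)
  with Cons show ?case by (auto simp: pivoted_def)
qed simp

text \<open>The last conjunct is the span condition in dual form: a functional that vanishes on the
  kept vectors vanishes on the basis and on everything processed. The support condition on basis
  vectors serves both the size bound and the final count.\<close>

definition elim_inv :: "(tree \<Rightarrow> tree) \<Rightarrow> tree list \<Rightarrow> tree \<Rightarrow> bool" where
  "elim_inv vec xs st \<longleftrightarrow>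
     pivoted (tree_list (left_subtree st)) \<and>
     (\<forall>b\<in>set (tree_list (left_subtree st)).
        set (tree_list b) \<subseteq> (\<Union>x\<in>set xs. set (tree_list (vec x)))) \<and>
     length (tree_list (left_subtree st)) = length (tree_list (right_subtree st)) \<and>
     length (tree_list (right_subtree st)) \<le> length xs \<and>
     set (tree_list (right_subtree st)) \<subseteq> set xs \<and>
     (distinct xs \<longrightarrow> distinct (tree_list (right_subtree st))) \<and>
     (\<forall>P. (\<forall>x\<in>set (tree_list (right_subtree st)). \<not> parity P (vec x)) \<longrightarrow>
        (\<forall>b\<in>set (tree_list (left_subtree st)). \<not> parity P b) \<and> (\<forall>x\<in>set xs. \<not> parity P (vec x)))"

lemma elim_inv_step:
  assumes "elim_inv vec xs st"
  shows "elim_inv vec (xs @ [x]) (elim_step vec x st)"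
proof -
  define B out where "B = left_subtree st" and "out = right_subtree st"
  \<comment> \<open>Adding the entries to the zero vector one by one cancels repetitions, so
    \<open>u\<close> is distinct even if \<open>vec x\<close> is not.\<close>
  define u where "u = xor_tree (vec x) Leaf"
  define v where "v = reduce B u"
  have piv: "pivoted (tree_list B)"
    and sub: "\<And>b. b \<in> set (tree_list B) \<Longrightarrow>
      set (tree_list b) \<subseteq> (\<Union>x\<in>set xs. set (tree_list (vec x)))"
    and len: "length (tree_list B) = length (tree_list out)" "length (tree_list out) \<le> length xs"
    and out: "set (tree_list out) \<subseteq> set xs" "distinct xs \<Longrightarrow> distinct (tree_list out)"
    and par: "\<And>P. \<forall>x\<in>set (tree_list out). \<not> parity P (vec x) \<Longrightarrow>
      (\<forall>b\<in>set (tree_list B). \<not> parity P b) \<and> (\<forall>x\<in>set xs. \<not> parity P (vec x))"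
    using assms unfolding elim_inv_def B_def[symmetric] out_def[symmetric] by blast+
  have du: "distinct (tree_list u)" unfolding u_def by (rule distinct_xor_tree) simp
  have dv: "distinct (tree_list v)" unfolding v_def by (rule distinct_reduce[OF du])
  have pu: "parity P u \<longleftrightarrow> parity P (vec x)" for P
    unfolding u_def by (subst parity_xor_tree) auto
  \<comment> \<open>\<open>v\<close> differs from \<open>u\<close> by basis vectors, on which
    \<open>P\<close> vanishes by the invariant. So \<open>v = Leaf\<close> means that
    \<open>vec x\<close> depends on the kept vectors.\<close>
  have pv: "parity P v \<longleftrightarrow> parity P (vec x)" if "\<forall>x\<in>set (tree_list out). \<not> parity P (vec x)" for P
    unfolding v_def using par[OF that] by (subst parity_reduce[OF du]) (auto simp: pu)
  have su: "set (tree_list u) \<subseteq> set (tree_list (vec x))"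
    using set_xor_tree[of "vec x" Leaf] by (simp add: u_def)
  have sv: "set (tree_list v) \<subseteq> (\<Union>x\<in>set (xs @ [x]). set (tree_list (vec x)))"
    using set_reduce[of B u] su sub unfolding v_def by fastforce
  have nv: "left_subtree b \<notin> set (tree_list v)" if "b \<in> set (tree_list B)" for b
    unfolding v_def by (rule pivots_not_in_reduce[OF piv that])
  show ?thesis
  proof (cases "v = Leaf")
    case True
    then have st: "elim_step vec x st = st"
      by (simp add: elim_step_def v_def u_def B_def)
    have "\<not> parity P (vec x)" if "\<forall>x\<in>set (tree_list out). \<not> parity P (vec x)" for P
      using pv[OF that] True by simp
    then have "(\<forall>b\<in>set (tree_list B). \<not> parity P b) \<and> (\<forall>y\<in>set (xs @ [x]). \<not> parity P (vec y))"
      if "\<forall>x\<in>set (tree_list out). \<not> parity P (vec x)" for P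
      using par[OF that] that by simp
    moreover have "set (tree_list b) \<subseteq> (\<Union>x\<in>set (xs @ [x]). set (tree_list (vec x)))"
      if "b \<in> set (tree_list B)" for b
      using sub[OF that] by auto
    moreover have "length (tree_list out) \<le> length (xs @ [x])"
        "set (tree_list out) \<subseteq> set (xs @ [x])"
        "distinct (xs @ [x]) \<longrightarrow> distinct (tree_list out)"
      using len out by auto
    ultimately show ?thesis
      unfolding st elim_inv_def B_def[symmetric] out_def[symmetric]
      using piv len(1) by blast
  next
    case False
    then have st: "elim_step vec x st = Branch (list_tree (tree_list B @ [v])) (Branch x out)"
      by (simp add: elim_step_def v_def u_def B_def out_def Let_def)
    have "pivoted (tree_list B @ [v])"
      using piv False dv nv by (auto simp: pivoted_def sorted_wrt_append)
    moreover have "distinct (xs @ [x]) \<longrightarrow> distinct (x # tree_list out)"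
      using out by auto
    moreover have "(\<forall>b\<in>set (tree_list B @ [v]). \<not> parity P b) \<and> (\<forall>y\<in>set (xs @ [x]). \<not> parity P (vec y))"
      if "\<forall>x\<in>set (x # tree_list out). \<not> parity P (vec x)" for P
      using par[of P] pv[of P] that by auto
    moreover have "set (tree_list b) \<subseteq> (\<Union>x\<in>set (xs @ [x]). set (tree_list (vec x)))"
      if "b \<in> set (tree_list B @ [v])" for b
      using that sub[of b] sv by auto
    moreover have "length (tree_list B @ [v]) = length (x # tree_list out)"
        "length (x # tree_list out) \<le> length (xs @ [x])"
        "set (x # tree_list out) \<subseteq> set (xs @ [x])"
      using len out by auto
    ultimately show ?thesis
      unfolding st elim_inv_def left_subtree.simps right_subtree.simps tree_list.simps
        tree_list_list_tree by blast
  qed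
qed

lemma elim_inv_fold: "elim_inv vec xs (fold (elim_step vec) xs Leaf)"
proof (induction xs rule: rev_induct)
  case Nil
  show ?case by (simp add: elim_inv_def pivoted_def)
next
  case (snoc x xs)
  then show ?case using elim_inv_step by simp
qed

lemma sum_list_distinct_le:
  fixes f :: "'a \<Rightarrow> nat"
  assumes "distinct xs" "set xs \<subseteq> (\<Union>y\<in>set ys. set (g y))"
  shows "sum_list (map f xs) \<le> (\<Sum>y\<leftarrow>ys. sum_list (map f (g y)))"
proof -
  have le: "sum f (set zs) \<le> sum_list (map f zs)" for zs
    by (induction zs) (auto simp: sum.insert_if)
  have "sum_list (map f xs) = sum f (set xs)"
    using assms(1) by (simp add: sum_list_distinct_conv_sum_set)
  also have "\<dots> \<le> sum f (set (concat (map g ys)))"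
    using assms(2) by (intro sum_mono2) auto
  also have "\<dots> \<le> sum_list (map f (concat (map g ys)))"
    by (rule le)
  also have "\<dots> = (\<Sum>y\<leftarrow>ys. sum_list (map f (g y)))"
    by (induction ys) auto
  finally show ?thesis .
qed

text \<open>A basis vector is duplicate-free with indices from the original vectors, so its size is
  at most their total size \<open>n * S\<close>, however many reductions produced it.\<close>

lemma size_elim_inv:
  assumes inv: "elim_inv vec xs st"
    and S: "\<And>x. x \<in> set xs \<Longrightarrow> size x \<le> S \<and> size (vec x) \<le> S" and "length xs \<le> n"
  shows "size st \<le> 1 + n * (1 + n * S) + n * (1 + S)"
proof -
  define B out where "B = left_subtree st" and "out = right_subtree st"
  have le: "sum_list (map f ys) \<le> n * k" if "length ys \<le> n" "\<And>y. y \<in> set ys \<Longrightarrow> f y \<le> k"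
    for f :: "tree \<Rightarrow> nat" and ys n k
    using that
  proof (induction ys arbitrary: n)
    case (Cons y ys)
    then obtain m where "n = Suc m" by (cases n) auto
    with Cons show ?case by (auto intro!: add_mono)
  qed simp
  have lenB: "length (tree_list B) \<le> n" and lenO: "length (tree_list out) \<le> n"
    using inv \<open>length xs \<le> n\<close> unfolding elim_inv_def B_def out_def by auto
  have b: "Suc (size b) \<le> 1 + n * S" if "b \<in> set (tree_list B)" for b
  proof -
    have "distinct (tree_list b)" "set (tree_list b) \<subseteq> (\<Union>x\<in>set xs. set (tree_list (vec x)))"
      using inv that unfolding elim_inv_def pivoted_def B_def by auto
    from sum_list_distinct_le[OF this, of "\<lambda>x. Suc (size x)"]
    have "size b \<le> (\<Sum>x\<leftarrow>xs. size (vec x))"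
      by (simp flip: size_tree_list)
    also have "\<dots> \<le> n * S" using S \<open>length xs \<le> n\<close> by (intro le) auto
    finally show ?thesis by simp
  qed
  have "size B \<le> n * (1 + n * S)"
    unfolding size_tree_list[of B] by (intro le lenB b)
  moreover have "size out \<le> n * (1 + S)"
    unfolding size_tree_list[of out]
    using S inv unfolding elim_inv_def out_def[symmetric] by (intro le lenO) auto
  moreover have "size st \<le> 1 + size B + size out"
    unfolding B_def out_def by (cases st) auto
  ultimately show ?thesis by linarith
qed

section \<open>Running time of the elimination\<close>

lemma polytime_toggle:
  "polytime f \<Longrightarrow> polytime g \<Longrightarrow> polytime (\<lambda>t. toggle (f t) (g t))"
proof (rule polytime_comp2[of toggle])
  show "polytime (\<lambda>w. toggle (left_subtree w) (right_subtree w))"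
    unfolding toggle_def by (intro polytime_intros)
qed

lemma size_toggle: "size (toggle x v) \<le> size v + Suc (size x)"
proof -
  have "size (list_tree (filter P xs)) \<le> size (list_tree xs)" for P xs
    by (induction xs) auto
  from this[of "\<lambda>y. y \<noteq> x" "tree_list v"] show ?thesis by (auto simp: toggle_def)
qed

lemma size_xor_tree: "size (xor_tree b v) \<le> size v + size b"
proof (induction b arbitrary: v)
  case (Branch x b)
  show ?case using Branch.IH(2)[of "toggle x v"] size_toggle[of x v] by simp
qed simp

lemma polytime_xor_tree:
  assumes "polytime f" "polytime g"
  shows "polytime (\<lambda>t. xor_tree (f t) (g t))"
  unfolding xor_tree_def
proof (rule polytime_fold[where g = "\<lambda>t. toggle" and p = "[:1, 1:]"])
  show "size (toggle x a) \<le> size a + poly [:1, 1:] (size t + size x)" for t x a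
    using size_toggle[of x a] by simp
qed (intro polytime_toggle polytime_intros assms)+

lemma polytime_reduce:
  assumes "polytime f" "polytime g"
  shows "polytime (\<lambda>t. reduce (f t) (g t))"
  unfolding reduce_def
proof (rule polytime_fold[where p = "[:0, 1:]" and
      g = "\<lambda>t b v. if left_subtree b \<in> set (tree_list v) then xor_tree b v else v"])
  show "size (if left_subtree x \<in> set (tree_list a) then xor_tree x a else a) \<le>
      size a + poly [:0, 1:] (size t + size x)" for t x a
    using size_xor_tree[of x a] by simp
qed (intro polytime_xor_tree polytime_intros assms)+

text \<open>A reduced vector can be as large as the new vector plus the whole basis, so a stepwise
  estimate would only exclude more than doubling. The bound from \<open>elim_inv\<close> is used
  instead.\<close>

lemma polytime_eliminate:
  assumes vec: "polytime (\<lambda>w. vec (left_subtree w) (right_subtree w))" and h: "polytime h"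
  shows "polytime (\<lambda>t. fold (elim_step (vec t)) (tree_list (h t)) Leaf)"
proof -
  obtain p where p: "\<And>w. size (vec (left_subtree w) (right_subtree w)) \<le> poly p (size w)"
    using polytime_poly_bounded[OF vec] unfolding poly_bounded_def by blast
  let ?S = "\<lambda>t. size (h t) + poly p (1 + (size t + size (h t)))"
  let ?T = "\<lambda>t. 1 + size (h t) * (1 + size (h t) * ?S t) + size (h t) * (1 + ?S t)"
  show ?thesis
  proof (rule polytime_fold_bounded[where p = ?T])
    show "polytime (\<lambda>w. elim_step (vec (left_subtree w)) (left_subtree (right_subtree w))
        (right_subtree (right_subtree w)))"
      unfolding elim_step_def Let_def
      by (intro polytime_reduce polytime_xor_tree polytime_intros polytime_comp2[OF vec])
    show "poly_bounded ?T"
      by (intro poly_bounded_intros poly_bounded_size polytime_poly_bounded h)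
    fix t ys zs assume *: "tree_list (h t) = ys @ zs"
    show "size (fold (elim_step (vec t)) ys Leaf) \<le> ?T t"
    proof (rule size_elim_inv[OF elim_inv_fold])
      show "length ys \<le> size (h t)" using length_tree_list[of "h t"] * by simp
      fix x assume "x \<in> set ys"
      then have x: "size x \<le> size (h t)" using * by (intro size_tree_list_elem) simp
      have "size (vec t x) \<le> poly p (size (Branch t x))" using p[of "Branch t x"] by simp
      also have "\<dots> \<le> poly p (1 + (size t + size (h t)))" using x by (intro poly_nat_mono) simp
      finally show "size x \<le> ?S t \<and> size (vec t x) \<le> ?S t" using x by simp
    qed
  qed (intro h polytime_intros)+
qed

text \<open>Listing a set in the order of \<open>V\<close> makes equal sets equal as trees.\<close>

definition canonical :: "tree \<Rightarrow> tree \<Rightarrow> tree" where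
  "canonical V S = list_tree (filter (\<lambda>v. v \<in> set (tree_list S)) (tree_list V))"

definition faces :: "tree \<Rightarrow> tree" where
  "faces S = list_tree (map (\<lambda>x. list_tree (filter (\<lambda>y. y \<noteq> x) (tree_list S))) (tree_list S))"

primrec product_tree :: "nat \<Rightarrow> tree \<Rightarrow> tree" where
  "product_tree 0 Ls = Branch Leaf Leaf"
| "product_tree (Suc l) Ls = list_tree (concat (map (\<lambda>x. tree_list (list_tree (map (Branch x)
     (tree_list (product_tree l (right_subtree Ls)))))) (tree_list (left_subtree Ls))))"

definition unary_length :: "tree \<Rightarrow> tree" where
  "unary_length xs = list_tree (map (\<lambda>_. Leaf) (tree_list xs))"

text \<open>The sizes \<open>d\<close> and \<open>l\<close> are recorded in unary, which avoids
  arithmetic on trees. All sets of a tuple have the same size, so the first one determines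
  \<open>d\<close>.\<close>

definition shape :: "tree \<Rightarrow> tree" where
  "shape ts = Branch (unary_length (left_subtree ts)) (unary_length ts)"

definition shape_of :: "nat \<Rightarrow> nat \<Rightarrow> tree" where
  "shape_of d l = Branch (list_tree (replicate d Leaf)) (list_tree (replicate l Leaf))"

text \<open>In the second case, taking the right subtree removes the first list of the product, which is \<open>ts\<close>.\<close>

definition boundary_tree :: "nat \<Rightarrow> nat \<Rightarrow> nat \<Rightarrow> tree \<Rightarrow> tree" where
  "boundary_tree q d l ts =
     (if l \<ge> 2 \<and> q \<ge> d + 2 \<or> l = 1 \<and> d \<le> 2 then Branch ts Leaf
      else if l \<ge> 2 \<and> q = d + 1 then
        right_subtree (product_tree l (list_tree (map (\<lambda>S. Branch S (faces S)) (tree_list ts))))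
      else product_tree l (list_tree (map faces (tree_list ts))))"

text \<open>Tagging with the shape prevents cancellation between constraints of different types \<open>(d, \<ell>)\<close>.\<close>

primrec vector :: "nat \<Rightarrow> (nat \<times> nat) list \<Rightarrow> tree \<Rightarrow> tree \<Rightarrow> tree" where
  "vector q [] V ts = Leaf"
| "vector q (i # Is) V ts =
     (if shape ts = shape_of (fst i) (snd i)
      then list_tree (map (Branch (shape ts)) (tree_list (boundary_tree q (fst i) (snd i)
        (list_tree (map (canonical V) (tree_list ts))))))
      else vector q Is V ts)"

text \<open>Constraints are kept as the original trees; canonical forms occur only inside the
  vectors. Vertices and edges are copied.\<close>

definition kernel :: "nat \<Rightarrow> (nat \<times> nat) list \<Rightarrow> tree \<Rightarrow> tree" where
  "kernel q Is t = Branch (left_subtree t) (Branch (left_subtree (right_subtree t))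
     (right_subtree (fold (elim_step (vector q Is (left_subtree t)))
       (tree_list (right_subtree (right_subtree t))) Leaf)))"

section \<open>Running time of the kernel\<close>

lemma polytime_canonical:
  "polytime f \<Longrightarrow> polytime g \<Longrightarrow> polytime (\<lambda>t. canonical (f t) (g t))"
proof (rule polytime_comp2[of canonical])
  show "polytime (\<lambda>w. canonical (left_subtree w) (right_subtree w))"
    unfolding canonical_def by (intro polytime_intros)
qed

lemma polytime_faces: "polytime f \<Longrightarrow> polytime (\<lambda>t. faces (f t))"
proof (rule polytime_comp[of faces])
  show "polytime faces" unfolding faces_def by (intro polytime_intros)
qed

text \<open>The recursion is over the fixed number \<open>l\<close>, not over the input, so
  induction on \<open>l\<close> yields one program and one polynomial for each
  \<open>l\<close>.\<close>

lemma polytime_product_tree: "polytime f \<Longrightarrow> polytime (\<lambda>t. product_tree l (f t))"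
proof (rule polytime_comp[of "product_tree l"])
  show "polytime (product_tree l)"
  proof (induction l)
    case (Suc l)
    show ?case
      unfolding product_tree.simps
      by (intro polytime_intros polytime_comp[OF Suc.IH])
  qed (simp add: polytime_const)
qed

lemma polytime_boundary_tree:
  assumes "polytime f"
  shows "polytime (\<lambda>t. boundary_tree q d l (f t))"
proof -
  \<comment> \<open>The case depends on the fixed parameters only and is settled before the program
    runs.\<close>
  consider "boundary_tree q d l = (\<lambda>ts. Branch ts Leaf)"
    | "boundary_tree q d l = (\<lambda>ts. right_subtree (product_tree l
        (list_tree (map (\<lambda>S. Branch S (faces S)) (tree_list ts)))))"
    | "boundary_tree q d l = (\<lambda>ts. product_tree l (list_tree (map faces (tree_list ts))))"
    unfolding boundary_tree_def
    by (cases "l \<ge> 2 \<and> q \<ge> d + 2 \<or> l = 1 \<and> d \<le> 2"; cases "l \<ge> 2 \<and> q = d + 1") fastforce+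
  then show ?thesis
    by cases (simp only:, intro polytime_product_tree polytime_faces polytime_intros assms)+
qed

lemma polytime_shape: "polytime f \<Longrightarrow> polytime (\<lambda>t. shape (f t))"
proof (rule polytime_comp[of shape])
  show "polytime shape" unfolding shape_def unary_length_def by (intro polytime_intros)
qed

lemma polytime_vector:
  assumes "polytime f" "polytime g"
  shows "polytime (\<lambda>t. vector q Is (f t) (g t))"
proof -
  have "polytime (\<lambda>w. vector q Is (left_subtree w) (right_subtree w))"
  proof (induction Is)
    case (Cons i Is)
    show ?case
      unfolding vector.simps
      by (intro polytime_boundary_tree polytime_canonical polytime_shape polytime_intros Cons.IH)
  qed (simp add: polytime_const)
  from polytime_comp2[OF this assms] show ?thesis .
qed

lemma polytime_kernel: "polytime (kernel q Is)"
  unfolding kernel_def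
  by (intro polytime_eliminate polytime_vector polytime_intros)

section \<open>Boundaries of tuples of sets\<close>

text \<open>If \<open>c\<close> is injective on \<open>F\<close>, deleting \<open>x\<close> removes
  exactly the color \<open>c x\<close>, so at most one face has color set \<open>A\<close>.
  Otherwise a face with color set \<open>A\<close> has \<open>k\<close> vertices and
  \<open>k\<close> colors, hence the deleted vertex belongs to the only pair of equal color;
  deleting the other vertex of the pair gives the same colors, and the count is 0 or 2.\<close>

lemma odd_card_faces:
  assumes F: "finite F" "card F = Suc k" and A: "finite A" "card A = k"
  shows "odd (card {x \<in> F. c ` (F - {x}) = A}) \<longleftrightarrow> card (c ` F) = Suc k \<and> A \<subseteq> c ` F"
proof (cases "inj_on c F")
  case True
  then have card: "card (c ` F) = Suc k" using F by (simp add: card_image)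
  have img: "c ` (F - {x}) = c ` F - {c x}" if "x \<in> F" for x
    using True that by (auto simp: inj_on_def)
  show ?thesis
  proof (cases "A \<subseteq> c ` F")
    case sub: True
    then have "card (c ` F - A) = 1"
      using card A F by (simp add: card_Diff_subset)
    then obtain a where a: "c ` F - A = {a}" by (auto simp: card_1_singleton_iff)
    then obtain y where y: "y \<in> F" "a = c y" by blast
    have "{x \<in> F. c ` (F - {x}) = A} = {y}"
    proof (intro equalityI subsetI; clarsimp)
      fix x assume x: "x \<in> F" "A = c ` (F - {x})"
      then have "c x \<in> c ` F - A" using img by auto
      then show "x = y" using a y x(1) True by (auto simp: inj_on_def)
    next
      show "y \<in> F \<and> c ` (F - {y}) = A" using y img[OF y(1)] a sub by blast
    qed
    then show ?thesis using card sub by simp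
  next
    case False
    then have "{x \<in> F. c ` (F - {x}) = A} = {}" by auto
    then show ?thesis using False by (simp only: card.empty) simp
  qed
next
  case False
  then have "card (c ` F) \<noteq> Suc k" using F eq_card_imp_inj_on[of F c] by auto
  moreover have "even (card {x \<in> F. c ` (F - {x}) = A})"
  proof (cases "{x \<in> F. c ` (F - {x}) = A} = {}")
    case nonempty: False
    have inj: "inj_on c (F - {z})" if "z \<in> F" "c ` (F - {z}) = A" for z
      using that F A by (intro eq_card_imp_inj_on) auto
    obtain x where x: "x \<in> F" "c ` (F - {x}) = A" using nonempty by blast
    obtain u w where uw: "u \<in> F" "w \<in> F" "u \<noteq> w" "c u = c w"
      using False by (auto simp: inj_on_def)
    have "u = x \<or> w = x" using inj_onD[OF inj[OF x] uw(4)] uw by blast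
    then obtain y where y: "y \<in> F" "y \<noteq> x" "c y = c x"
      using uw by metis
    have "{x \<in> F. c ` (F - {x}) = A} = {x, y}"
    proof (intro equalityI subsetI; clarsimp)
      fix z assume z: "z \<in> F" "A = c ` (F - {z})" "z \<noteq> y"
      show "z = x"
        using inj[of z] z y x(1) by (auto simp: inj_on_def)
    next
      fix z assume "z = x \<or> z = y"
      moreover have "c ` (F - {y}) = c ` (F - {x})"
      proof -
        have "F - {y} = insert x (F - {x, y})" "F - {x} = insert y (F - {x, y})"
          using x(1) y by auto
        then show ?thesis using y(3) by (simp only: image_insert)
      qed
      ultimately show "z \<in> F \<and> c ` (F - {z}) = A" using x y by auto
    qed
    then show ?thesis using y by simp
  qed (simp only: card.empty dvd_0_right)
  ultimately show ?thesis by blast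
qed

text \<open>A functional of product form is multiplicative on products of vectors, which reduces
  tuples to single sets.\<close>

lemma count_product_lists:
  "length (filter (\<lambda>Ts. \<forall>T\<in>set Ts. p T) (product_lists Ls)) =
    prod_list (map (\<lambda>L. length (filter p L)) Ls)"
proof (induction Ls)
  case (Cons L Ls)
  have "length (filter (\<lambda>Ts. \<forall>T\<in>set Ts. p T) (concat (map (\<lambda>x. map ((#) x) R) L))) =
      length (filter p L) * length (filter (\<lambda>Ts. \<forall>T\<in>set Ts. p T) R)" for R :: "'a list list"
    by (induction L) (auto simp: filter_map o_def)
  then show ?case using Cons by simp
qed simp

lemma odd_prod_list: "odd (prod_list ns) \<longleftrightarrow> (\<forall>n\<in>set ns. odd n)" for ns :: "nat list"
  by (induction ns) auto

text \<open>The order of \<open>Vs\<close> is fixed so that the list matches the trees computed by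
  \<open>faces\<close> entry by entry.\<close>

definition face_list :: "nat list \<Rightarrow> nat set \<Rightarrow> nat set list" where
  "face_list Vs F = map (\<lambda>x. F - {x}) (filter (\<lambda>v. v \<in> F) Vs)"

definition boundary :: "nat \<Rightarrow> nat \<Rightarrow> nat \<Rightarrow> nat list \<Rightarrow> nat set list \<Rightarrow> nat set list list" where
  "boundary q d l Vs Fs =
     (if l \<ge> 2 \<and> q \<ge> d + 2 \<or> l = 1 \<and> d \<le> 2 then [Fs]
      else if l \<ge> 2 \<and> q = d + 1 then
        tl (product_lists (map (\<lambda>F. F # face_list Vs F) Fs))
      else product_lists (map (face_list Vs) Fs))"

text \<open>Taking the head of every factor gives the first entry of the product; hence
  \<open>tl\<close> removes exactly the term of full degree.\<close>

lemma product_lists_full_first: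
  "product_lists (map (\<lambda>F. F # g F) Fs) = Fs # tl (product_lists (map (\<lambda>F. F # g F) Fs))"
proof (induction Fs)
  case (Cons F Fs)
  obtain R where "product_lists (map (\<lambda>F. F # g F) Fs) = Fs # R" using Cons by metis
  then show ?case by simp
qed simp

lemma count_face_list:
  assumes "distinct Vs" "F \<subseteq> set Vs"
  shows "length (filter p (face_list Vs F)) = card {x \<in> F. p (F - {x})}"
proof -
  have "length (filter p (face_list Vs F)) = length (filter (\<lambda>x. x \<in> F \<and> p (F - {x})) Vs)"
    unfolding face_list_def by (simp add: filter_map o_def conj_commute)
  also have "\<dots> = card {x \<in> F. p (F - {x})}"
    unfolding distinct_length_filter[OF assms(1)]
    using assms(2) by (intro arg_cong[where f = card]) auto
  finally show ?thesis .
qed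

lemma boundary_separates:
  assumes Vs: "distinct Vs" and c: "c \<in> set Vs \<rightarrow> {1..q}"
    and dl: "d > 0" "l > 0" "q \<ge> d"
    and Fs0: "Fs0 \<in> subset_tuples (set Vs) d l" "uniformly_rainbow d c Fs0"
  obtains Q where "odd (length (filter Q (boundary q d l Vs Fs0)))"
    "\<And>Fs. Fs \<in> subset_tuples (set Vs) d l \<Longrightarrow> odd (length (filter Q (boundary q d l Vs Fs))) \<Longrightarrow>
      uniformly_rainbow d c Fs"
proof -
  obtain k where k: "d = Suc k" using dl by (cases d) auto
  obtain C where C: "card C = d" "\<And>F. F \<in> set Fs0 \<Longrightarrow> c ` F = C"
    using Fs0(2) unfolding uniformly_rainbow_def by blast
  have finC: "finite C" using C(1) dl by (auto intro: card_ge_0_finite)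
  have tup: "length Fs = l" "\<And>F. F \<in> set Fs \<Longrightarrow> F \<subseteq> set Vs \<and> card F = Suc k \<and> finite F"
    if "Fs \<in> subset_tuples (set Vs) d l" for Fs
    using that by (auto simp: subset_tuples_def k intro: finite_subset)
  have ne: "Fs0 \<noteq> []" using tup(1)[OF Fs0(1)] dl by auto
  have Cq: "C \<subseteq> {1..q}"
    using ne C(2)[of "hd Fs0"] tup(2)[OF Fs0(1), of "hd Fs0"] c by fastforce
  have "C \<noteq> {}" using C(1) dl by auto
  then obtain a where a: "a \<in> C" by blast
  \<comment> \<open>Any color of the common color set \<open>C\<close> may be dropped to obtain a
    functional that detects \<open>Fs0\<close>.\<close>
  define A where "A = C - {a}"
  have A: "finite A" "card A = k" "a \<notin> A" "C = insert a A"
    using finC C(1) a by (auto simp: A_def k)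
  have odd_faces: "odd (length (filter (\<lambda>T. c ` T = A) (face_list Vs F))) \<longleftrightarrow>
      card (c ` F) = Suc k \<and> A \<subseteq> c ` F"
    if "F \<subseteq> set Vs" "card F = Suc k" "finite F" for F
    using that by (subst count_face_list[OF Vs that(1)]) (rule odd_card_faces; use A in simp)
  consider (trivial) "l \<ge> 2 \<and> q \<ge> d + 2 \<or> l = 1 \<and> d \<le> 2"
    | (mixed) "\<not> (l \<ge> 2 \<and> q \<ge> d + 2 \<or> l = 1 \<and> d \<le> 2)" "l \<ge> 2" "q = d + 1"
    | (faces) "\<not> (l \<ge> 2 \<and> q \<ge> d + 2 \<or> l = 1 \<and> d \<le> 2)" "\<not> (l \<ge> 2 \<and> q = d + 1)"
    by blast
  then show thesis
  proof cases
    case trivial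
    then have "boundary q d l Vs Fs = [Fs]" for Fs by (simp add: boundary_def)
    then show thesis using Fs0(2) by (intro that[of "\<lambda>Fs. Fs = Fs0"]) (auto split: if_splits)
  next
    case faces
    then have bd: "boundary q d l Vs Fs = product_lists (map (face_list Vs) Fs)" for Fs
      unfolding boundary_def by (simp only: if_False)
    have odd_iff: "odd (length (filter (\<lambda>Ts. \<forall>T\<in>set Ts. c ` T = A) (boundary q d l Vs Fs))) \<longleftrightarrow>
        (\<forall>F\<in>set Fs. card (c ` F) = Suc k \<and> A \<subseteq> c ` F)"
      if "Fs \<in> subset_tuples (set Vs) d l" for Fs
      unfolding bd count_product_lists odd_prod_list list.map_comp o_def set_map ball_simps(9)
      by (intro ball_cong refl odd_faces) (use tup(2)[OF that] in blast)+
    show thesis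
    proof (rule that)
      show "odd (length (filter (\<lambda>Ts. \<forall>T\<in>set Ts. c ` T = A) (boundary q d l Vs Fs0)))"
        unfolding odd_iff[OF Fs0(1)] using C A k by auto
      fix Fs assume Fs: "Fs \<in> subset_tuples (set Vs) d l"
        and "odd (length (filter (\<lambda>Ts. \<forall>T\<in>set Ts. c ` T = A) (boundary q d l Vs Fs)))"
      then have card: "\<And>F. F \<in> set Fs \<Longrightarrow> card (c ` F) = d"
        using odd_iff[OF Fs] k by blast
      \<comment> \<open>A rainbow set is enough in both situations: a single set is trivially
        uniform, and for \<open>q = d\<close> every rainbow set uses all colors.\<close>
      have "l = 1 \<or> q = d" using faces dl by linarith
      then show "uniformly_rainbow d c Fs"
      proof
        assume "l = 1"
        then obtain F where "Fs = [F]" using tup(1)[OF Fs] by (auto simp: length_Suc_conv)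
        then show ?thesis using card unfolding uniformly_rainbow_def by auto
      next
        assume "q = d"
        have "c ` F = {1..q}" if "F \<in> set Fs" for F
          using card[OF that] tup(2)[OF Fs that] c \<open>q = d\<close>
          by (intro card_subset_eq) auto
        then show ?thesis using \<open>q = d\<close> unfolding uniformly_rainbow_def
          by (intro exI[of _ "{1..q}"]) auto
      qed
    qed
  next
    case mixed
    let ?G = "\<lambda>F. F # face_list Vs F"
    \<comment> \<open>The cardinality separates faces from full sets; without it a full set that is
      not rainbow but has color set \<open>A\<close> would be counted as a face.\<close>
    let ?p = "\<lambda>T. card T = k \<and> c ` T = A \<or> card T = Suc k \<and> c ` T = C"
    let ?Q = "\<lambda>Ts. \<forall>T\<in>set Ts. ?p T"
    from mixed have bd: "boundary q d l Vs Fs = tl (product_lists (map ?G Fs))" for Fs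
      unfolding boundary_def by (simp only: if_False if_True simp_thms)
    have G: "odd (length (filter ?p (?G F))) \<longleftrightarrow>
        (c ` F = C) \<noteq> (card (c ` F) = Suc k \<and> A \<subseteq> c ` F)"
      if "F \<subseteq> set Vs" "card F = Suc k" "finite F" for F
    proof -
      have "filter ?p (face_list Vs F) = filter (\<lambda>T. c ` T = A) (face_list Vs F)"
        using that by (intro filter_cong) (auto simp: face_list_def)
      then show ?thesis using odd_faces[OF that] that by auto
    qed
    have odd_Cons: "odd (length (filter P (x # xs))) \<longleftrightarrow> P x \<noteq> odd (length (filter P xs))"
      for P and x :: "nat set list" and xs
      by simp
    have odd_iff: "odd (length (filter ?Q (boundary q d l Vs Fs))) \<longleftrightarrow>
        (\<forall>F\<in>set Fs. (c ` F = C) \<noteq> (card (c ` F) = Suc k \<and> A \<subseteq> c ` F)) \<noteq>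
        (\<forall>F\<in>set Fs. c ` F = C)"
      if "Fs \<in> subset_tuples (set Vs) d l" for Fs
    proof -
      have "odd (length (filter ?Q (product_lists (map ?G Fs)))) \<longleftrightarrow>
          (\<forall>F\<in>set Fs. (c ` F = C) \<noteq> (card (c ` F) = Suc k \<and> A \<subseteq> c ` F))"
        unfolding count_product_lists odd_prod_list list.map_comp o_def set_map ball_simps(9)
        by (intro ball_cong refl G) (use tup(2)[OF that] in blast)+
      moreover have "?Q Fs \<longleftrightarrow> (\<forall>F\<in>set Fs. c ` F = C)"
        using tup(2)[OF that] by (intro ball_cong refl) simp
      \<comment> \<open>The term \<open>Fs\<close> dropped by \<open>tl\<close> contributes its own
        truth value to the parity.\<close>
      moreover have "odd (length (filter ?Q (product_lists (map ?G Fs)))) \<longleftrightarrow>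
          ?Q Fs \<noteq> odd (length (filter ?Q (boundary q d l Vs Fs)))"
        unfolding bd by (subst product_lists_full_first) (rule odd_Cons)
      ultimately show ?thesis by argo
    qed
    show thesis
    proof (rule that)
      \<comment> \<open>All sets of the nonempty tuple \<open>Fs0\<close> have color set
        \<open>C\<close>, so the first product vanishes and the second is 1.\<close>
      show "odd (length (filter ?Q (boundary q d l Vs Fs0)))"
        unfolding odd_iff[OF Fs0(1)] using C A k ne by (cases Fs0) auto
      fix Fs assume Fs: "Fs \<in> subset_tuples (set Vs) d l"
        and odd: "odd (length (filter ?Q (boundary q d l Vs Fs)))"
      show "uniformly_rainbow d c Fs"
      proof (cases "\<forall>F\<in>set Fs. c ` F = C")
        case True
        then show ?thesis using C(1) unfolding uniformly_rainbow_def by blast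
      next
        case False
        with odd odd_iff[OF Fs] have "\<forall>F\<in>set Fs. (c ` F = C) \<noteq> (card (c ` F) = Suc k \<and> A \<subseteq> c ` F)"
          by argo
        then have all: "(c ` F = C) \<noteq> (card (c ` F) = Suc k \<and> A \<subseteq> c ` F)" if "F \<in> set Fs" for F
          using that by (rule bspec)
        \<comment> \<open>As \<open>q = d + 1\<close>, a single color \<open>a'\<close> lies outside
          \<open>C\<close>. Every set of \<open>Fs\<close> has the colors of \<open>A\<close> and
          one more color different from \<open>a\<close>, which must be \<open>a'\<close>; so the
          color sets agree.\<close>
        have "card ({1..q} - C) = 1" using mixed C(1) Cq finC by (simp add: card_Diff_subset)
        then obtain a' where a': "{1..q} - C = {a'}" by (auto simp: card_1_singleton_iff)
        have "c ` F = insert a' A" if "F \<in> set Fs" for F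
        proof -
          have F: "card (c ` F) = Suc k" "A \<subseteq> c ` F" "c ` F \<noteq> C"
            using all[OF that] A C(1) k by auto
          have fin: "finite (c ` F)" using tup(2)[OF Fs that] by simp
          have "card (c ` F - A) = 1" using F A fin by (simp add: card_Diff_subset)
          then obtain b where b: "c ` F - A = {b}" by (auto simp: card_1_singleton_iff)
          then have "c ` F = insert b A" using F(2) by blast
          moreover have "b \<noteq> a" using calculation F(3) A(4) by blast
          moreover have "b \<in> {1..q}"
          proof -
            have "c ` F \<subseteq> {1..q}" using c tup(2)[OF Fs that] by auto
            with b show ?thesis by blast
          qed
          moreover have "b \<notin> A" using b by blast
          ultimately have "b \<in> {1..q} - C" using A(4) by simp
          then have "b = a'" unfolding a' by simp
          with \<open>c ` F = insert b A\<close> show ?thesis by simp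
        qed
        moreover have "card (insert a' A) = d"
        proof -
          have "a' \<notin> A" using a' A(4) by blast
          then show ?thesis using A k by simp
        qed
        ultimately show ?thesis unfolding uniformly_rainbow_def by blast
      qed
    qed
  qed
qed

text \<open>It ensures that \<open>Fs\<close> occurs only once in the product, so that no term of
  full degree is left after \<open>tl\<close>.\<close>

lemma distinct_face_list:
  assumes "distinct Vs"
  shows "distinct (F # face_list Vs F)"
proof -
  have "inj_on (\<lambda>x. F - {x}) (set (filter (\<lambda>v. v \<in> F) Vs))"
    by (auto simp: inj_on_def)
  then show ?thesis using assms by (auto simp: face_list_def distinct_map)
qed

text \<open>The total number of vertices in an index tuple is its degree; bounding it by
  \<open>eta\<close> is the source of the exponent.\<close>

lemma boundary_elem:
  assumes Vs: "distinct Vs" and dl: "d > 0" "l > 0" "q \<ge> d" "eta d l q \<ge> 2"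
    and Fs: "Fs \<in> subset_tuples (set Vs) d l" and Ts: "Ts \<in> set (boundary q d l Vs Fs)"
  shows "length Ts = l" "set Ts \<subseteq> Pow (set Vs)" "\<forall>T\<in>set Ts. card T \<le> d"
    "sum_list (map card Ts) \<le> eta d l q"
proof -
  have len: "length Fs = l" and F: "\<And>F. F \<in> set Fs \<Longrightarrow> F \<subseteq> set Vs \<and> card F = d \<and> finite F"
    using Fs by (auto simp: subset_tuples_def intro: finite_subset)
  have face: "T \<subseteq> F" "card T = d - 1" if "T \<in> set (face_list Vs F)" "F \<in> set Fs" for T F
    using that F by (auto simp: face_list_def)
  have "length Ts = l \<and> set Ts \<subseteq> Pow (set Vs) \<and> (\<forall>T\<in>set Ts. card T \<le> d) \<and>
      sum_list (map card Ts) \<le> eta d l q"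
  proof (cases "l \<ge> 2 \<and> q \<ge> d + 2 \<or> l = 1 \<and> d \<le> 2")
    case True
    then have "Ts = Fs" using Ts by (simp add: boundary_def)
    moreover have "sum_list (map card Fs) = d * l"
    proof -
      have "map card Fs = replicate l d"
        using len F by (intro replicate_eqI) auto
      then show ?thesis by (simp add: sum_list_replicate)
    qed
    \<comment> \<open>For \<open>d = l = 1\<close> the inequality is strict, as \<open>eta\<close>
      is then 2.\<close>
    moreover have "d * l \<le> eta d l q"
      using True dl by (auto simp: eta_def split: if_splits)
    ultimately show ?thesis using len F by auto
  next
    case nontriv: False
    show ?thesis
    proof (cases "l \<ge> 2 \<and> q = d + 1")
      case True
      let ?G = "\<lambda>F. F # face_list Vs F"
      have bd: "boundary q d l Vs Fs = tl (product_lists (map ?G Fs))"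
        using nontriv True unfolding boundary_def by (simp only: if_False if_True simp_thms)
      have "distinct (product_lists (map ?G Fs))"
        using distinct_face_list[OF Vs] by (intro distinct_product_lists) auto
      then have "distinct (Fs # boundary q d l Vs Fs)"
        unfolding bd using product_lists_full_first[of "face_list Vs" Fs] by metis
      then have "Ts \<noteq> Fs" using Ts by auto
      have "Ts \<in> set (product_lists (map ?G Fs))"
        using Ts unfolding bd by (subst product_lists_full_first) simp
      then have "list_all2 (\<lambda>T F. T \<in> set (?G F)) Ts Fs"
        unfolding product_lists_set by (simp add: list_all2_map2)
      then have all2: "list_all2 (\<lambda>T F. T \<subseteq> set Vs \<and> (T = F \<and> card T = d \<or> card T = d - 1)) Ts Fs"
        by (rule list.rel_mono_strong) (use face F in fastforce)
      have "length Ts = length Fs \<and> set Ts \<subseteq> Pow (set Vs) \<and> (\<forall>T\<in>set Ts. card T \<le> d) \<and>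
          sum_list (map card Ts) \<le> d * length Fs \<and>
          (Ts \<noteq> Fs \<longrightarrow> sum_list (map card Ts) < d * length Fs)"
        using all2 by (induction rule: list_all2_induct) (use dl in auto)
      \<comment> \<open>The exceptional pair \<open>d = 1\<close>, \<open>l = 2\<close> has
        \<open>eta\<close> equal to 0 for \<open>q = 2\<close> and is excluded by the hypothesis on
        \<open>eta\<close>.\<close>
      moreover have "eta d l q = d * l - 1"
        using True dl by (auto simp: eta_def split: if_splits)
      ultimately show ?thesis using \<open>Ts \<noteq> Fs\<close> len by auto
    next
      case False
      have "Ts \<in> set (product_lists (map (face_list Vs) Fs))"
        using Ts nontriv False unfolding boundary_def by (simp only: if_False if_True simp_thms)
      then have "list_all2 (\<lambda>T F. T \<in> set (face_list Vs F)) Ts Fs"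
        unfolding product_lists_set by (simp add: list_all2_map2)
      then have all2: "list_all2 (\<lambda>T F. T \<subseteq> set Vs \<and> card T = d - 1) Ts Fs"
        by (rule list.rel_mono_strong) (use face F in fastforce)
      have "length Ts = length Fs \<and> set Ts \<subseteq> Pow (set Vs) \<and> (\<forall>T\<in>set Ts. card T \<le> d) \<and>
          sum_list (map card Ts) = (d - 1) * length Fs"
        using all2 by (induction rule: list_all2_induct) (use dl in auto)
      moreover have "eta d l q = (d - 1) * l"
      proof -
        \<comment> \<open>In the third case \<open>eta\<close> is 0, which contradicts the
          hypothesis.\<close>
        consider "l = 1" "d \<ge> 3" | "l \<ge> 2" "q = d" "d \<ge> 2" | "l \<ge> 2" "q = d" "d = 1"
          using False nontriv dl(1-3) by linarith
        then show ?thesis using dl(4) by cases (simp_all add: eta_def)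
      qed
      ultimately show ?thesis using len by auto
    qed
  qed
  then show "length Ts = l" "set Ts \<subseteq> Pow (set Vs)" "\<forall>T\<in>set Ts. card T \<le> d"
    "sum_list (map card Ts) \<le> eta d l q" by auto
qed

section \<open>Counting index tuples\<close>

lemma card_subset_lists_le:
  assumes "finite V"
  shows "finite {Ts. map card Ts = ks \<and> set Ts \<subseteq> Pow V}"
    "card {Ts. map card Ts = ks \<and> set Ts \<subseteq> Pow V} \<le> card V ^ sum_list ks"
proof -
  have "finite {Ts. map card Ts = ks \<and> set Ts \<subseteq> Pow V} \<and>
    card {Ts. map card Ts = ks \<and> set Ts \<subseteq> Pow V} \<le> card V ^ sum_list ks"
  proof (induction ks)
    case Nil
    have "{Ts. map card Ts = [] \<and> set Ts \<subseteq> Pow V} = {[]}" by auto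
    then show ?case by simp
  next
    case (Cons k ks)
    let ?S = "{T. T \<subseteq> V \<and> card T = k}" and ?R = "{Ts. map card Ts = ks \<and> set Ts \<subseteq> Pow V}"
    have eq: "{Ts. map card Ts = k # ks \<and> set Ts \<subseteq> Pow V} = (\<lambda>(T, Ts). T # Ts) ` (?S \<times> ?R)"
      by (auto simp: map_eq_Cons_conv image_iff) blast+
    have S: "finite ?S" using assms by simp
    have "card ?S \<le> card V ^ k"
      using n_subsets[OF assms, of k] binomial_le_pow[of k "card V"]
      by (cases "k \<le> card V") (auto simp: binomial_eq_0)
    then have "card (?S \<times> ?R) \<le> card V ^ k * card V ^ sum_list ks"
      using Cons by (simp add: card_cartesian_product mult_mono)
    then have "card ((\<lambda>(T, Ts). T # Ts) ` (?S \<times> ?R)) \<le> card V ^ k * card V ^ sum_list ks"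
      using card_image_le[of "?S \<times> ?R" "\<lambda>(T, Ts). T # Ts"] S Cons by (simp add: order_trans)
    then show ?case unfolding eq using S Cons by (simp add: power_add)
  qed
  then show "finite {Ts. map card Ts = ks \<and> set Ts \<subseteq> Pow V}"
    "card {Ts. map card Ts = ks \<and> set Ts \<subseteq> Pow V} \<le> card V ^ sum_list ks" by auto
qed

text \<open>Tuples are grouped by their list of cardinalities. There are at most
  \<open>Suc d ^ l\<close> such lists, and each allows at most \<open>card V ^ e\<close> tuples;
  nonemptiness of \<open>V\<close> makes powers monotone in the exponent.\<close>

lemma card_bounded_subset_lists_le:
  fixes V :: "nat set" and d l e :: nat
  assumes V: "finite V" "V \<noteq> {}"
  defines "U \<equiv> {Ts. length Ts = l \<and> set Ts \<subseteq> Pow V \<and> (\<forall>T\<in>set Ts. card T \<le> d) \<and>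
    sum_list (map card Ts) \<le> e}"
  shows "finite U" "card U \<le> Suc d ^ l * card V ^ e"
proof -
  let ?K = "{ks. set ks \<subseteq> {..d} \<and> length ks = l \<and> sum_list ks \<le> e}"
  let ?L = "\<lambda>ks. {Ts. map card Ts = ks \<and> set Ts \<subseteq> Pow V}"
  have sub: "?K \<subseteq> {ks. set ks \<subseteq> {..d} \<and> length ks = l}" by auto
  have fin: "finite {ks. set ks \<subseteq> {..d} \<and> length ks = l}" by (rule finite_lists_length_eq) simp
  have K: "finite ?K" "card ?K \<le> Suc d ^ l"
    using finite_subset[OF sub fin] card_mono[OF fin sub] by (auto simp: card_lists_length_eq)
  have U: "U \<subseteq> (\<Union>ks\<in>?K. ?L ks)" by (auto simp: U_def)
  have finL: "finite (\<Union>ks\<in>?K. ?L ks)" using K card_subset_lists_le(1)[OF V(1)] by blast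
  show "finite U" using U finL by (rule finite_subset)
  have "card U \<le> card (\<Union>ks\<in>?K. ?L ks)" using finL U by (rule card_mono)
  also have "\<dots> \<le> (\<Sum>ks\<in>?K. card (?L ks))" using K(1) by (rule card_UN_le)
  also have "\<dots> \<le> (\<Sum>ks\<in>?K. card V ^ e)"
  proof (rule sum_mono)
    fix ks assume "ks \<in> ?K"
    moreover have "card V \<ge> 1" using V by (simp add: Suc_le_eq card_gt_0_iff)
    ultimately have "card V ^ sum_list ks \<le> card V ^ e" by (intro power_increasing) auto
    with card_subset_lists_le(2)[OF V(1), of ks] show "card (?L ks) \<le> card V ^ e" by linarith
  qed
  also have "\<dots> \<le> Suc d ^ l * card V ^ e" using K(2) by simp
  finally show "card U \<le> Suc d ^ l * card V ^ e" .
qed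

section \<open>Translation between index tuples and trees\<close>

definition set_tree :: "nat list \<Rightarrow> nat set \<Rightarrow> tree" where
  "set_tree Vs T = list_tree (map nat_tree (filter (\<lambda>v. v \<in> T) Vs))"

definition tuple_tree :: "nat \<Rightarrow> nat \<Rightarrow> nat list \<Rightarrow> nat set list \<Rightarrow> tree" where
  "tuple_tree d l Vs Ts = Branch (shape_of d l) (list_tree (map (set_tree Vs) Ts))"

lemma inj_nat_tree: "inj nat_tree"
  by (auto simp: inj_def dest: nat_tree_inject)

lemma inj_list_tree: "inj list_tree"
  by (auto simp: inj_def dest: list_tree_inject)

lemma shape_of_inject: "shape_of d l = shape_of d' l' \<longleftrightarrow> d = d' \<and> l = l'"
  unfolding shape_of_def by (auto dest!: list_tree_inject dest: arg_cong[where f = length])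

lemma inj_on_set_tree: "inj_on (set_tree Vs) (Pow (set Vs))"
proof (rule inj_onI)
  fix S T assume "S \<in> Pow (set Vs)" "T \<in> Pow (set Vs)" "set_tree Vs S = set_tree Vs T"
  then have "filter (\<lambda>v. v \<in> S) Vs = filter (\<lambda>v. v \<in> T) Vs"
    unfolding set_tree_def using inj_nat_tree inj_list_tree
    by (metis injD inj_mapI)
  then have "set (filter (\<lambda>v. v \<in> S) Vs) = set (filter (\<lambda>v. v \<in> T) Vs)" by simp
  then show "S = T" using \<open>S \<in> Pow (set Vs)\<close> \<open>T \<in> Pow (set Vs)\<close> by auto
qed

lemma tuple_tree_inject:
  assumes "set Ts \<subseteq> Pow (set Vs)" "set Ts' \<subseteq> Pow (set Vs)"
  shows "tuple_tree d l Vs Ts = tuple_tree d' l' Vs Ts' \<longleftrightarrow> d = d' \<and> l = l' \<and> Ts = Ts'"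
proof -
  have "map (set_tree Vs) Ts = map (set_tree Vs) Ts' \<longleftrightarrow> Ts = Ts'"
    using assms by (intro inj_on_map_eq_map inj_on_subset[OF inj_on_set_tree]) auto
  then show ?thesis
    unfolding tuple_tree_def by (auto simp: shape_of_inject dest!: list_tree_inject)
qed

lemma encodes_nat_list: "list_all2 encodes_nat xs ts \<longleftrightarrow> ts = map nat_tree xs"
  by (induction xs arbitrary: ts) (auto simp: list_all2_Cons1 encodes_nat_def)

lemma encodes_nat_setE:
  assumes "encodes_set encodes_nat S t"
  obtains xs where "distinct xs" "set xs = S" "t = list_tree (map nat_tree xs)"
  using assms unfolding encodes_set_def encodes_list_def encodes_nat_list by blast

lemma canonical_set_tree:
  assumes "encodes_set encodes_nat S t"
  shows "canonical (list_tree (map nat_tree Vs)) t = set_tree Vs S"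
proof -
  obtain xs where xs: "set xs = S" "t = list_tree (map nat_tree xs)"
    using encodes_nat_setE[OF assms] by metis
  have "nat_tree v \<in> nat_tree ` S \<longleftrightarrow> v \<in> S" for v using inj_nat_tree by (auto simp: inj_def)
  then show ?thesis by (simp add: canonical_def set_tree_def filter_map o_def xs)
qed

lemma faces_set_tree: "faces (set_tree Vs S) = list_tree (map (set_tree Vs) (face_list Vs S))"
proof -
  have [simp]: "nat_tree x = nat_tree y \<longleftrightarrow> x = y" for x y using inj_nat_tree by (auto simp: inj_def)
  have "list_tree (filter (\<lambda>y. y \<noteq> nat_tree x) (map nat_tree (filter (\<lambda>v. v \<in> S) Vs))) =
      set_tree Vs (S - {x})" for x
    by (simp add: set_tree_def filter_map o_def conj_commute)
  then show ?thesis
    by (simp add: faces_def face_list_def o_def set_tree_def[of Vs S])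
qed

lemma product_tree_product_lists:
  "product_tree (length Lss) (list_tree (map list_tree Lss)) =
    list_tree (map list_tree (product_lists Lss))"
  by (induction Lss) (simp_all add: map_concat o_def)

lemma product_lists_map: "product_lists (map (map f) Ls) = map (map f) (product_lists Ls)"
  by (induction Ls) (simp_all add: map_concat o_def)

lemma boundary_tree_boundary:
  assumes "length Fs = l"
  shows "boundary_tree q d l (list_tree (map (set_tree Vs) Fs)) =
    list_tree (map (\<lambda>Ts. list_tree (map (set_tree Vs) Ts)) (boundary q d l Vs Fs))"
proof -
  have P: "product_tree l (list_tree (map (\<lambda>F. list_tree (map (set_tree Vs) (g F))) Fs)) =
      list_tree (map (\<lambda>Ts. list_tree (map (set_tree Vs) Ts)) (product_lists (map g Fs)))" for g
    using product_tree_product_lists[of "map (map (set_tree Vs)) (map g Fs)"] assms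
    unfolding product_lists_map by (simp add: o_def)
  have R: "right_subtree (list_tree xs) = list_tree (tl xs)" for xs by (cases xs) auto
  show ?thesis
    using P[of "face_list Vs"] P[of "\<lambda>F. F # face_list Vs F"]
    by (simp add: boundary_tree_def boundary_def o_def faces_set_tree R map_tl)
qed

lemma vector_boundary:
  assumes Fs: "Fs \<in> subset_tuples (set Vs) d l" and dl: "l > 0" "(d, l) \<in> set Is"
    and t: "encodes_list (encodes_set encodes_nat) Fs t"
  shows "tree_list (vector q Is (list_tree (map nat_tree Vs)) t) =
    map (tuple_tree d l Vs) (boundary q d l Vs Fs)"
proof -
  obtain us where us: "list_all2 (encodes_set encodes_nat) Fs us" "t = list_tree us"
    using t unfolding encodes_list_def by blast
  have len: "length Fs = l" "length us = l"
    using Fs list_all2_lengthD[OF us(1)] by (auto simp: subset_tuples_def)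
  obtain u us' F Fs' where cons: "us = u # us'" "Fs = F # Fs'" "encodes_set encodes_nat F u"
    using us(1) len dl by (cases us; cases Fs) auto
  \<comment> \<open>Set encodings have no repetitions, so the length of the first list is the
    cardinality of the first set, which exists because \<open>l > 0\<close>.\<close>
  have "length (tree_list u) = d"
  proof -
    obtain xs where "distinct xs" "set xs = F" "u = list_tree (map nat_tree xs)"
      using encodes_nat_setE[OF cons(3)] by metis
    moreover have "card F = d" using Fs cons by (auto simp: subset_tuples_def)
    ultimately show ?thesis using distinct_card[of xs] by simp
  qed
  then have shape: "shape t = shape_of d l"
    using len by (simp add: shape_def shape_of_def unary_length_def us(2) cons map_replicate_const)
  have canon: "map (canonical (list_tree (map nat_tree Vs))) (tree_list t) = map (set_tree Vs) Fs"
    using us(1) unfolding us(2)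
    by (induction rule: list_all2_induct) (auto simp: canonical_set_tree)
  show ?thesis using dl(2)
  proof (induction Is)
    case (Cons i Is)
    show ?case
    proof (cases "i = (d, l)")
      case True
      then show ?thesis
        using boundary_tree_boundary[OF len(1)] by (simp add: shape canon tuple_tree_def o_def)
    next
      case False
      then have "shape_of d l \<noteq> shape_of (fst i) (snd i)" by (auto simp: shape_of_inject prod_eq_iff)
      then show ?thesis using Cons False by (simp add: shape)
    qed
  qed simp
qed

section \<open>Correctness of the kernel\<close>

text \<open>A functional on tuples of sets is transported to trees and restricted to one tag, so
  that it vanishes on constraints of every other type.\<close>

lemma parity_vector:
  assumes Vs: "distinct Vs" and dl: "d > 0" "l > 0" "q \<ge> d" "eta d l q \<ge> 2" "(d, l) \<in> set Is"
    and Fs: "Fs \<in> subset_tuples (set Vs) d l"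
    and t: "encodes_list (encodes_set encodes_nat) Fs t"
  shows "parity (\<lambda>w. \<exists>Ts. set Ts \<subseteq> Pow (set Vs) \<and> w = tuple_tree d' l' Vs Ts \<and> Q Ts)
      (vector q Is (list_tree (map nat_tree Vs)) t) \<longleftrightarrow>
    (d', l') = (d, l) \<and> odd (length (filter Q (boundary q d l Vs Fs)))"
proof -
  let ?P = "\<lambda>w. \<exists>Ts. set Ts \<subseteq> Pow (set Vs) \<and> w = tuple_tree d' l' Vs Ts \<and> Q Ts"
  have P: "?P (tuple_tree d l Vs Ts) \<longleftrightarrow> (d', l') = (d, l) \<and> Q Ts"
    if "Ts \<in> set (boundary q d l Vs Fs)" for Ts
  proof -
    have Ts: "set Ts \<subseteq> Pow (set Vs)" using boundary_elem(2)[OF Vs dl(1-4) Fs that] .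
    have "?P (tuple_tree d l Vs Ts) \<longleftrightarrow>
        (\<exists>Ts'. set Ts' \<subseteq> Pow (set Vs) \<and> (d = d' \<and> l = l' \<and> Ts = Ts') \<and> Q Ts')"
      using tuple_tree_inject[OF Ts] by blast
    then show ?thesis using Ts by auto
  qed
  have "filter ?P (map (tuple_tree d l Vs) (boundary q d l Vs Fs)) =
      map (tuple_tree d l Vs) (filter (\<lambda>Ts. (d', l') = (d, l) \<and> Q Ts) (boundary q d l Vs Fs))"
    unfolding filter_map o_def by (intro arg_cong[where f = "map _"] filter_cong refl P)
  then show ?thesis
    unfolding parity_def vector_boundary[OF Fs dl(2) dl(5) t] length_map
    by (cases "d' = d"; cases "l' = l") simp_all
qed

lemma kernel_correct:
  assumes I: "finite I" "set Is = I"
    and dl: "\<And>d l. (d, l) \<in> I \<Longrightarrow> d > 0 \<and> l > 0 \<and> d \<le> q \<and> 2 \<le> eta d l q \<and> eta d l q \<le> e"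
    and inst: "is_instance I (V, E, \<F>)" and enc: "encodes_inst (V, E, \<F>) t"
  obtains \<F>' where "encodes_inst (V, E, \<F>') (kernel q Is t)" "\<F>' \<subseteq> \<F>"
    "solutions I q (V, E, \<F>') = solutions I q (V, E, \<F>)"
    "card \<F>' \<le> (\<Sum>(d, l)\<in>I. Suc d ^ l) * card V ^ e"
proof -
  let ?R = "encodes_list (encodes_set encodes_nat)"
  obtain tV tE tF where t: "t = Branch tV (Branch tE tF)" and tV: "encodes_set encodes_nat V tV"
    and tE: "encodes_set (encodes_set encodes_nat) E tE" and tF: "encodes_set ?R \<F> tF"
    using enc by auto
  obtain Vs where Vs: "distinct Vs" "set Vs = V" "tV = list_tree (map nat_tree Vs)"
    using encodes_nat_setE[OF tV] .
  obtain xs ts where xs: "distinct xs" "set xs = \<F>" "list_all2 ?R xs ts" "tF = list_tree ts"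
    using tF unfolding encodes_set_def encodes_list_def[of ?R] by blast
  define vec where "vec = vector q Is tV"
  define st where "st = fold (elim_step vec) ts Leaf"
  define out where "out = tree_list (right_subtree st)"
  have inv: "elim_inv vec ts st" unfolding st_def by (rule elim_inv_fold)
  have out: "set out \<subseteq> set ts" "distinct ts \<Longrightarrow> distinct out"
    and len: "length (tree_list (left_subtree st)) = length out"
    and piv: "pivoted (tree_list (left_subtree st))"
    and sub: "\<And>b. b \<in> set (tree_list (left_subtree st)) \<Longrightarrow>
      set (tree_list b) \<subseteq> (\<Union>u\<in>set ts. set (tree_list (vec u)))"
    and par: "\<And>P. \<forall>u\<in>set out. \<not> parity P (vec u) \<Longrightarrow>
      (\<forall>b\<in>set (tree_list (left_subtree st)). \<not> parity P b) \<and> (\<forall>u\<in>set ts. \<not> parity P (vec u))"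
    using inv unfolding elim_inv_def out_def[symmetric] by blast+
  \<comment> \<open>Elimination works on trees; \<open>dec\<close> recovers the tuple that a tree
    encodes, which is unique since encodings are left-unique.\<close>
  define dec where "dec u = (THE x. ?R x u)" for u
  have uniq: "left_unique ?R"
    by (intro left_unique_encodes_list left_unique_encodes_set left_unique_encodes_nat)
  have dec: "dec u = x" if "?R x u" for x u
    unfolding dec_def using that uniq by (intro the_equality) (auto simp: left_unique_def)
  have xs_dec: "xs = map dec ts" and R_dec: "\<forall>u\<in>set ts. ?R (dec u) u"
    using xs(3) by (induction rule: list_all2_induct) (auto simp: dec)
  have "distinct ts" and inj: "inj_on dec (set ts)"
    using xs(1) unfolding xs_dec by (auto simp: distinct_map)
  define \<F>' where "\<F>' = dec ` set out"
  have dist: "distinct (map dec out)"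
    using out \<open>distinct ts\<close> inj by (auto simp: distinct_map intro: inj_on_subset)
  have F_dec: "\<F> = dec ` set ts" using xs(2) xs_dec by simp
  have sub': "\<F>' \<subseteq> \<F>" unfolding \<F>'_def F_dec using out by blast
  have "list_all2 ?R (map dec out) out"
    using R_dec out(1) by (auto simp: list_all2_map1 list_all2_same)
  then have "encodes_set ?R \<F>' (list_tree out)"
    unfolding encodes_set_def encodes_list_def[of ?R] \<F>'_def using dist by fastforce
  moreover have "kernel q Is t = Branch tV (Branch tE (list_tree out))"
    by (simp add: kernel_def t out_def st_def vec_def xs(4))
  ultimately have 1: "encodes_inst (V, E, \<F>') (kernel q Is t)"
    using tV tE by auto
  have tup: "\<exists>d l. (d, l) \<in> I \<and> dec u \<in> subset_tuples (set Vs) d l" if "u \<in> set ts" for u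
  proof -
    have "dec u \<in> (\<Union>(d, l)\<in>I. subset_tuples V d l)"
      using inst that unfolding is_instance.simps F_dec by blast
    then show ?thesis using Vs(2) by auto
  qed
  have parity_vec: "parity (\<lambda>w. \<exists>Ts. set Ts \<subseteq> Pow (set Vs) \<and> w = tuple_tree d' l' Vs Ts \<and> Q Ts) (vec u) \<longleftrightarrow>
      (d', l') = (d, l) \<and> odd (length (filter Q (boundary q d l Vs (dec u))))"
    if "u \<in> set ts" "(d, l) \<in> I" "dec u \<in> subset_tuples (set Vs) d l" for u d l d' l' Q
    unfolding vec_def Vs(3)
    by (rule parity_vector) (use that dl[OF that(2)] R_dec Vs(1) I(2) in auto)
  have 2: "solutions I q (V, E, \<F>') = solutions I q (V, E, \<F>)"
  proof
    show "solutions I q (V, E, \<F>) \<subseteq> solutions I q (V, E, \<F>')" using sub' by fastforce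
    show "solutions I q (V, E, \<F>') \<subseteq> solutions I q (V, E, \<F>)"
    proof
      fix c assume c: "c \<in> solutions I q (V, E, \<F>')"
      have "\<not> uniformly_rainbow d c Fs0"
        if i: "(d, l) \<in> I" and Fs0: "Fs0 \<in> \<F>" "Fs0 \<in> subset_tuples V d l" for d l Fs0
      proof
        assume "uniformly_rainbow d c Fs0"
        moreover have "c \<in> set Vs \<rightarrow> {1..q}" using c Vs(2) by auto
        ultimately obtain Q where Q: "odd (length (filter Q (boundary q d l Vs Fs0)))"
          "\<And>Fs. Fs \<in> subset_tuples (set Vs) d l \<Longrightarrow>
            odd (length (filter Q (boundary q d l Vs Fs))) \<Longrightarrow> uniformly_rainbow d c Fs"
          using boundary_separates[of Vs c q d l Fs0] Vs(1,2) dl[OF i] Fs0(2) by blast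
        let ?P = "\<lambda>w. \<exists>Ts. set Ts \<subseteq> Pow (set Vs) \<and> w = tuple_tree d l Vs Ts \<and> Q Ts"
        obtain u0 where u0: "u0 \<in> set ts" "Fs0 = dec u0" using Fs0(1) F_dec by blast
        have "parity ?P (vec u0)"
          using parity_vec[OF u0(1) i] Fs0(2) Q(1) u0(2) Vs(2) by simp
        \<comment> \<open>The functional is nonzero on \<open>vec u0\<close>, so by the span
          condition it cannot vanish on all kept vectors. A kept constraint detected by it is
          uniformly rainbow, although \<open>c\<close> solves the kernel.\<close>
        then obtain u where u: "u \<in> set out" "parity ?P (vec u)"
          using par[of ?P] u0(1) by blast
        then have uts: "u \<in> set ts" using out(1) by blast
        obtain d' l' where d'l': "(d', l') \<in> I" "dec u \<in> subset_tuples (set Vs) d' l'"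
          using tup[OF uts] by blast
        have "(d, l) = (d', l')" and "odd (length (filter Q (boundary q d' l' Vs (dec u))))"
          using u(2) parity_vec[OF uts d'l'] by simp_all
        then have "uniformly_rainbow d c (dec u)" using Q(2) d'l'(2) by simp
        moreover have "dec u \<in> \<F>' \<inter> subset_tuples V d l"
          using u(1) d'l'(2) \<open>(d, l) = (d', l')\<close> Vs(2) by (simp add: \<F>'_def)
        ultimately show False using c i by auto
      qed
      then show "c \<in> solutions I q (V, E, \<F>)" using c by auto
    qed
  qed
  have 3: "card \<F>' \<le> (\<Sum>(d, l)\<in>I. Suc d ^ l) * card V ^ e"
  proof (cases "V = {}")
    case True
    \<comment> \<open>The bound is 0 here; positive \<open>d\<close> and \<open>l\<close> leave no
      tuple over the empty set.\<close>
    have "subset_tuples V d l = {}" if "(d, l) \<in> I" for d l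
    proof -
      have "\<not> (length Fs = l \<and> (\<forall>S\<in>set Fs. S \<subseteq> {} \<and> card S = d))" for Fs :: "nat set list"
        using dl[OF that] by (cases Fs) auto
      then show ?thesis by (simp add: subset_tuples_def True)
    qed
    then have "\<F> = {}" using inst by fastforce
    then show ?thesis using sub' by simp
  next
    case False
    have finV: "finite V" using Vs(2) by blast
    let ?U = "\<lambda>d l. {Ts. length Ts = l \<and> set Ts \<subseteq> Pow V \<and> (\<forall>T\<in>set Ts. card T \<le> d) \<and>
      sum_list (map card Ts) \<le> e}"
    let ?X = "\<Union>(d, l)\<in>I. tuple_tree d l Vs ` ?U d l"
    have finU: "finite (?U d l)" "card (?U d l) \<le> Suc d ^ l * card V ^ e" for d l
      using card_bounded_subset_lists_le[OF finV False] by blast+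
    have finX: "finite ?X" using I(1) finU(1) by auto
    have X: "set (tree_list (vec u)) \<subseteq> ?X" if u: "u \<in> set ts" for u
    proof -
      obtain d l where i: "(d, l) \<in> I" "dec u \<in> subset_tuples (set Vs) d l"
        using tup[OF u] by blast
      have "tree_list (vec u) = map (tuple_tree d l Vs) (boundary q d l Vs (dec u))"
        unfolding vec_def Vs(3) using i R_dec u dl[OF i(1)] I(2)
        by (intro vector_boundary) auto
      moreover have "Ts \<in> ?U d l" if "Ts \<in> set (boundary q d l Vs (dec u))" for Ts
        using boundary_elem[OF Vs(1) _ _ _ _ i(2) that] dl[OF i(1)] Vs(2) by fastforce
      ultimately show ?thesis using i(1) by fastforce
    qed
    \<comment> \<open>There is one basis vector per kept constraint; their pivots are distinct and
      are index trees from \<open>?X\<close>.\<close>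
    have "card \<F>' \<le> length out"
      unfolding \<F>'_def using card_image_le[of "set out" dec] card_length[of out] by simp
    also have "\<dots> = card (left_subtree ` set (tree_list (left_subtree st)))"
      using distinct_card[OF distinct_pivots[OF piv]] by (simp add: len[symmetric])
    also have "\<dots> \<le> card ?X"
    proof (rule card_mono[OF finX], rule image_subsetI)
      fix b assume b: "b \<in> set (tree_list (left_subtree st))"
      then have "left_subtree b \<in> set (tree_list b)"
        using piv by (intro left_subtree_mem) (auto simp: pivoted_def)
      then show "left_subtree b \<in> ?X" using sub[OF b] X by blast
    qed
    also have "\<dots> \<le> (\<Sum>(d, l)\<in>I. card (tuple_tree d l Vs ` ?U d l))"
      using card_UN_le[OF I(1), of "\<lambda>(d, l). tuple_tree d l Vs ` ?U d l"]
      by (simp add: case_prod_unfold)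
    also have "\<dots> \<le> (\<Sum>(d, l)\<in>I. Suc d ^ l * card V ^ e)"
    proof (rule sum_mono, clarify)
      fix d l
      show "card (tuple_tree d l Vs ` ?U d l) \<le> Suc d ^ l * card V ^ e"
        using card_image_le[OF finU(1)] finU(2) by (rule order_trans)
    qed
    also have "\<dots> = (\<Sum>(d, l)\<in>I. Suc d ^ l) * card V ^ e"
      by (simp add: sum_distrib_right case_prod_unfold)
    finally show ?thesis .
  qed
  show thesis by (rule that[OF 1 sub' 2 3])
qed

lemma card_edges_le:
  assumes "finite V" "E \<subseteq> {e. e \<subseteq> V \<and> card e = 2}" "e \<ge> 2"
  shows "card E \<le> card V ^ e"
proof (cases "V = {}")
  case True
  then have "E = {}" using assms(2) by auto
  then show ?thesis by simp
next
  case False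
  have "card E \<le> card {e. e \<subseteq> V \<and> card e = 2}" using assms by (intro card_mono) auto
  also have "\<dots> = card V choose 2" using assms by (simp add: n_subsets)
  also have "\<dots> \<le> card V ^ 2"
    using binomial_le_pow[of 2 "card V"] by (cases "2 \<le> card V") (auto simp: binomial_eq_0)
  also have "\<dots> \<le> card V ^ e"
    using False assms by (intro power_increasing) (auto simp: Suc_le_eq card_gt_0_iff)
  finally show ?thesis .
qed

theorem theorem5p7:
  fixes m q \<eta> :: nat and I :: "(nat \<times> nat) set"
  assumes "m > 0" and "q > 0"
    and "finite I" and "card I = m"
    and "\<forall>(d, l)\<in>I. d > 0 \<and> l > 0"
    and "q \<ge> (MAX (d, l)\<in>I. d)"
    and "\<forall>(d, l)\<in>I. eta d l q \<ge> 2"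
    and "\<eta> = (MAX (d, l)\<in>I. eta d l q)"
  shows "\<exists>K. constraint_kernel I q \<eta> K \<and>
    (\<forall>V E \<F> t. is_instance I (V, E, \<F>) \<and> encodes_inst (V, E, \<F>) t \<longrightarrow>
      (\<exists>\<F>' t'. computes K t t' \<and> encodes_inst (V, E, \<F>') t' \<and> \<F>' \<subseteq> \<F> \<and>
        solutions I q (V, E, \<F>') = solutions I q (V, E, \<F>)))"
proof -
  obtain Is where Is: "set Is = I" using finite_list[OF \<open>finite I\<close>] by blast
  have dl: "d > 0 \<and> l > 0 \<and> d \<le> q \<and> 2 \<le> eta d l q \<and> eta d l q \<le> \<eta>" if i: "(d, l) \<in> I" for d l
  proof -
    have "d \<le> (MAX (d, l)\<in>I. d)"
      using i assms(3) by (intro Max_ge) (auto intro: rev_image_eqI)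
    moreover have "eta d l q \<le> \<eta>"
      unfolding assms(8) using i assms(3) by (intro Max_ge) (auto intro: rev_image_eqI)
    ultimately show ?thesis using assms(5,6,7) i by auto
  qed
  obtain d0 l0 where "(d0, l0) \<in> I" using assms(1,4) by (metis card.empty less_numeral_extra(3) ex_in_conv surj_pair)
  \<comment> \<open>All edges are retained, and an exponent of at least 2 is what absorbs
    them.\<close>
  then have \<eta>: "\<eta> \<ge> 2" using dl order_trans by blast
  obtain K N b where K: "realizes K N b (kernel q Is)"
    using polytime_kernel unfolding polytime_def by blast
  have runs: "\<exists>n. computes_in K t n (kernel q Is t) \<and> n \<le> poly b (size t)" for t
  proof -
    obtain s where "runs K ((\<lambda>_. Leaf)(0 := t)) (poly b (size t)) s" "s 0 = kernel q Is t"
      using realizesD[OF K, of "(\<lambda>_. Leaf)(0 := t)"] by (metis fun_upd_same)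
    then show ?thesis unfolding runs_def computes_in_def by blast
  qed
  then have comp: "computes K t (kernel q Is t)" for t unfolding computes_def by blast
  \<comment> \<open>The summand 1 accounts for the edges.\<close>
  let ?C = "1 + (\<Sum>(d, l)\<in>I. Suc d ^ l)"
  have main: "\<exists>\<F>'. encodes_inst (V, E, \<F>') (kernel q Is t) \<and> \<F>' \<subseteq> \<F> \<and>
      solutions I q (V, E, \<F>') = solutions I q (V, E, \<F>) \<and> is_instance I (V, E, \<F>') \<and>
      card E + card \<F>' \<le> ?C * card V ^ \<eta>"
    if inst: "is_instance I (V, E, \<F>)" and enc: "encodes_inst (V, E, \<F>) t" for V E \<F> t
  proof -
    obtain \<F>' where F': "encodes_inst (V, E, \<F>') (kernel q Is t)" "\<F>' \<subseteq> \<F>"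
      "solutions I q (V, E, \<F>') = solutions I q (V, E, \<F>)"
      "card \<F>' \<le> (\<Sum>(d, l)\<in>I. Suc d ^ l) * card V ^ \<eta>"
      using kernel_correct[OF \<open>finite I\<close> Is dl inst enc] by blast
    moreover have "is_instance I (V, E, \<F>')" using inst F'(2) by auto
    moreover have "card E \<le> card V ^ \<eta>" using inst \<eta> by (intro card_edges_le) auto
    then have "card E + card \<F>' \<le> ?C * card V ^ \<eta>"
      using F'(4) by (simp add: distrib_right)
    ultimately show ?thesis by blast
  qed
  have "constraint_kernel I q \<eta> K"
    unfolding constraint_kernel_def polynomial_time_on_def
  proof (intro conjI)
    show "\<exists>b. \<forall>t\<in>{t. \<exists>X. is_instance I X \<and> encodes_inst X t}.
        \<exists>n t'. computes_in K t n t' \<and> n \<le> poly b (size t)"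
      using runs by blast
    show "\<exists>C. \<forall>X t. is_instance I X \<and> encodes_inst X t \<longrightarrow>
        (\<exists>X' t'. computes K t t' \<and> encodes_inst X' t' \<and> is_instance I X' \<and>
          (solutions I q X' \<noteq> {} \<longleftrightarrow> solutions I q X \<noteq> {}) \<and>
          num_constraints X' \<le> C * num_vertices X ^ \<eta>)"
    proof (intro exI[of _ ?C] allI impI)
      fix X t assume X: "is_instance I X \<and> encodes_inst X t"
      obtain V E \<F> where "X = (V, E, \<F>)" by (cases X)
      with X obtain \<F>' where "encodes_inst (V, E, \<F>') (kernel q Is t)"
        "solutions I q (V, E, \<F>') = solutions I q X" "is_instance I (V, E, \<F>')"
        "num_constraints (V, E, \<F>') \<le> ?C * num_vertices X ^ \<eta>"
        using main[of V E \<F> t] by (metis num_constraints.simps num_vertices.simps)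
      then show "\<exists>X' t'. computes K t t' \<and> encodes_inst X' t' \<and> is_instance I X' \<and>
          (solutions I q X' \<noteq> {} \<longleftrightarrow> solutions I q X \<noteq> {}) \<and>
          num_constraints X' \<le> ?C * num_vertices X ^ \<eta>"
        using comp[of t] by metis
    qed
  qed
  then show ?thesis using main comp by blast
qed

end
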